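(* Let $\varphi\in S^2(\mathbb{R})$ and $\psi\in S^1(\mathbb{R})$ be given, and consider the initial value problem $$\begin{cases}\partial^S_tu_t-\partial^S_xu_x=0,&(x,t)\in\mathbb{R}\times(0,\infty),\\ u(x,0)=\varphi(x),&x\in\mathbb{R},\\ u_t(x,0)=\psi(x),&x\in\mathbb{R}.\end{cases}$$ Assume that $(\partial_t-\partial_x)u$ has a strong specular tangent hyperplane at each point $(x,t)\in\mathbb{R}\times(0,\infty)$. Then the $S^2$-solution of this problem (the solution $u\in S^2(\mathbb{R}\times[0,\infty))$) is given by d'Alembert's formula $$u(x,t)=\frac12\left[\varphi(x+t)+\varphi(x-t)\right]+\frac12\int_{x-t}^{x+t}\psi(s)\,ds.$$
   Context: Here $u_t=\partial_tu$, $u_x=\partial_xu$ are classical partial derivatives; $\partial^S_t,\partial^S_x$ are specular partial derivatives. Let $\Omega\subset\mathbb{R}^n$ be open, $v:\Omega\to\mathbb{R}$, $e_i$ the $i$-th standard basis vector. One-sided limits: $v[a)_{(i)}=\lim_{h\searrow0}v(a+he_i)$, $v(a]_{(i)}=\lim_{h\nearrow0}v(a+he_i)$, $v[a]_{(i)}=\frac12(v[a)_{(i)}+v(a]_{(i)})$; if all $v[a]_{(i)}$ agree, the common value is $v[a]$. Specular partial derivatives: $\partial^R_{x_i}v(a)=\lim_{h\searrow0}\frac{v(a+he_i)-v[a)_{(i)}}{h}$, $\partial^L_{x_i}v(a)=\lim_{h\nearrow0}\frac{v(a+he_i)-v(a]_{(i)}}{h}$ (real numbers). $\partial^S_{x_i}v(a)$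 exists if both exist and $v[a)_{(i)}=v(a]_{(i)}$; with $\alpha_i=\partial^R_{x_i}v(a)$, $\beta_i=\partial^L_{x_i}v(a)$ it equals $A(\alpha_i,\beta_i)$ if $\alpha_i+\beta_i\ne0$ and $0$ otherwise, where $A(\alpha,\beta)=\frac{\alpha\beta-1+\sqrt{(\alpha^2+1)(\beta^2+1)}}{\alpha+\beta}$. For a multi-index $\alpha$, $(\partial^S)^\alpha v=(\partial^S_{x_1})^{\alpha_1}\cdots(\partial^S_{x_n})^{\alpha_n}v$ with $(\partial^S_{x_i})^0v=v$, $|\alpha|=\sum\alpha_i$; $\partial^S_{x_ix_j}v:=\partial^S_{x_j}\partial^S_{x_i}v$. Singular hyperplanes: an affine hyperplane $\hbar$ in a set $X\subset\mathbb{R}^n$ is given by an equation $c\cdot x=b$, $x\in X$ ($c\in\mathbb{R}^n\setminus\{0\}$, $b\in\mathbb{R}$), with graph $\mathcal{G}(\hbar)=\{x\in X:c\cdot x=b\}$. If $\hbar$ is such a hyperplane in a connected subset of $\Omega$ and there is a variable $x_i$ with $v(x]_{(i)}\ne v[x)_{(i)}$ for all $x\in\mathcal{G}(\hbar)$, then $\hbar$ is a singular hyperplane of $v$. Piecewise continuity: $v$ is piecewise continuous if there are $m\ge0$ singular hyperplanes $\hbar_1,\dots,\hbar_m$ of $v$ in $\Omega$ such that $v$ is continuous in $\Omega\setminus\bigcup_\ell\mathcal{G}(\hbar_\ell)$ and, for each $\ell$, the restriction of $v$ to $\mathcal{G}(\hbar_\ell)$ is continuous on $\mathcal{G}(\hbar_\ell)\setminus\bigcup_{j\ne\ell}\mathcal{G}(\hbar_j)$.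 $S^0(\Omega)$ (proper functions): all piecewise continuous $v:\Omega\to\mathbb{R}$ such that for every $a\in\Omega$ and every $i$, $v(a)=A(v(a]_{(i)},v[a)_{(i)})$ if $v(a]_{(i)}+v[a)_{(i)}\ne0$, and $v(a)=0$ if $v(a]_{(i)}+v[a)_{(i)}=0$. $S^k(\Omega)$ for $k\ge1$: all continuous $v:\Omega\to\mathbb{R}$ such that (i) if $|\alpha|\le k$, $(\partial^S)^\alpha v$ exists and is in $S^0(\Omega)$; (ii) if $|\alpha|\le k-2$, $\partial^S_{x_ix_j}(\partial^S)^\alpha v$ is continuous in $\Omega$ whenever $i\ne j$. On $\mathbb{R}\times[0,\infty)$ the space is understood analogously, with one-sided limits and derivatives in $t$ at $t=0$. Strong specular tangent hyperplane ($n=2$; variables $x_1=x$, $x_2=t$): the phototangent of $v$ at $a$ with respect to $x_i$ is the graph over the line $a+\mathbb{R}e_i$ of the function equal, at $a+he_i$, to $\beta_ih+v(a]_{(i)}$ if $h<0$, $v[a]_{(i)}$ if $h=0$, $\alpha_ih+v[a)_{(i)}$ if $h>0$. $\mathcal{P}(v,a)$ is the set of all intersection points in $\mathbb{R}^3$ of the phototangents (for those $i$ with respect to which $v$ is specularly partial differentiable at $a$) with the unit sphere centred at $(a,v[a]_{(i)})$. $v$ is specularly differentiable at $a$ if $|\mathcal{P}(v,a)|=4$ and $v[a]_{(1)}=v[a]_{(2)}$. A strong specular tangent hyperplane to the graph of $v$ at $(a,v[a])$ is a plane in $\mathbb{R}^3$ containing all four points of $\mathcal{P}(v,a)$, where $v$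 is specularly differentiable at $a$; "$v$ has a strong specular tangent hyperplane at the point $a$" means it has one at $(a,v[a])$. *)

theory Defs
  imports "HOL-Analysis.Analysis"
begin

text \<open>
  A domain \<open>X\<close> is an open set of a Euclidean space or the closed half-plane below.  Where only one
  side of the point \<open>a\<close> along \<open>e\<close> lies in \<open>X\<close> (the half-plane at \<open>t = 0\<close>, in direction \<open>t\<close>), the
  limits and difference quotients of the missing side are taken on the available side; at every
  other point \<open>right_side\<close> and \<open>left_side\<close> are \<open>at_right 0\<close> and \<open>at_left 0\<close>.  All notions depend
  only on the values of \<open>v\<close> on \<open>X\<close>.
\<close>

definition right_side :: "'a::euclidean_space set \<Rightarrow> 'a \<Rightarrow> 'a \<Rightarrow> real filter" where
  "right_side X e a =
     (if \<forall>\<^sub>F h in at_right 0. a + h *\<^sub>R e \<in> X then at_right 0 else at_left 0)"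

definition left_side :: "'a::euclidean_space set \<Rightarrow> 'a \<Rightarrow> 'a \<Rightarrow> real filter" where
  "left_side X e a =
     (if \<forall>\<^sub>F h in at_left 0. a + h *\<^sub>R e \<in> X then at_left 0 else at_right 0)"

definition has_right_limit ::
    "'a::euclidean_space set \<Rightarrow> 'a \<Rightarrow> ('a \<Rightarrow> real) \<Rightarrow> 'a \<Rightarrow> real \<Rightarrow> bool" where
  "has_right_limit X e v a l \<longleftrightarrow> ((\<lambda>h. v (a + h *\<^sub>R e)) \<longlongrightarrow> l) (right_side X e a)"

definition has_left_limit ::
    "'a::euclidean_space set \<Rightarrow> 'a \<Rightarrow> ('a \<Rightarrow> real) \<Rightarrow> 'a \<Rightarrow> real \<Rightarrow> bool" where
  "has_left_limit X e v a l \<longleftrightarrow> ((\<lambda>h. v (a + h *\<^sub>R e)) \<longlongrightarrow> l) (left_side X e a)"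

definition one_sided_limits_exist ::
    "'a::euclidean_space set \<Rightarrow> 'a \<Rightarrow> ('a \<Rightarrow> real) \<Rightarrow> 'a \<Rightarrow> bool" where
  "one_sided_limits_exist X e v a \<longleftrightarrow>
     (\<exists>l. has_right_limit X e v a l) \<and> (\<exists>l. has_left_limit X e v a l)"

definition right_limit :: "'a::euclidean_space set \<Rightarrow> 'a \<Rightarrow> ('a \<Rightarrow> real) \<Rightarrow> 'a \<Rightarrow> real" where
  "right_limit X e v a = (THE l. has_right_limit X e v a l)"

definition left_limit :: "'a::euclidean_space set \<Rightarrow> 'a \<Rightarrow> ('a \<Rightarrow> real) \<Rightarrow> 'a \<Rightarrow> real" where
  "left_limit X e v a = (THE l. has_left_limit X e v a l)"

definition mid_limit :: "'a::euclidean_space set \<Rightarrow> 'a \<Rightarrow> ('a \<Rightarrow> real) \<Rightarrow> 'a \<Rightarrow> real" where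
  "mid_limit X e v a = (right_limit X e v a + left_limit X e v a) / 2"

definition has_right_derivative ::
    "'a::euclidean_space set \<Rightarrow> 'a \<Rightarrow> ('a \<Rightarrow> real) \<Rightarrow> 'a \<Rightarrow> real \<Rightarrow> bool" where
  "has_right_derivative X e v a d \<longleftrightarrow>
     (\<exists>l. has_right_limit X e v a l) \<and>
     ((\<lambda>h. (v (a + h *\<^sub>R e) - right_limit X e v a) / h) \<longlongrightarrow> d) (right_side X e a)"

definition has_left_derivative ::
    "'a::euclidean_space set \<Rightarrow> 'a \<Rightarrow> ('a \<Rightarrow> real) \<Rightarrow> 'a \<Rightarrow> real \<Rightarrow> bool" where
  "has_left_derivative X e v a d \<longleftrightarrow>
     (\<exists>l. has_left_limit X e v a l) \<and>
     ((\<lambda>h. (v (a + h *\<^sub>R e) - left_limit X e v a) / h) \<longlongrightarrow> d) (left_side X e a)"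

definition right_derivative :: "'a::euclidean_space set \<Rightarrow> 'a \<Rightarrow> ('a \<Rightarrow> real) \<Rightarrow> 'a \<Rightarrow> real" where
  "right_derivative X e v a = (THE d. has_right_derivative X e v a d)"

definition left_derivative :: "'a::euclidean_space set \<Rightarrow> 'a \<Rightarrow> ('a \<Rightarrow> real) \<Rightarrow> 'a \<Rightarrow> real" where
  "left_derivative X e v a = (THE d. has_left_derivative X e v a d)"

definition specular_mean :: "real \<Rightarrow> real \<Rightarrow> real" where
  "specular_mean \<alpha> \<beta> =
     (if \<alpha> + \<beta> \<noteq> 0 then (\<alpha> * \<beta> - 1 + sqrt ((\<alpha>\<^sup>2 + 1) * (\<beta>\<^sup>2 + 1))) / (\<alpha> + \<beta>) else 0)"

definition specularly_partial_differentiable ::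
    "'a::euclidean_space set \<Rightarrow> 'a \<Rightarrow> ('a \<Rightarrow> real) \<Rightarrow> 'a \<Rightarrow> bool" where
  "specularly_partial_differentiable X e v a \<longleftrightarrow>
     (\<exists>\<alpha>. has_right_derivative X e v a \<alpha>) \<and> (\<exists>\<beta>. has_left_derivative X e v a \<beta>) \<and>
     right_limit X e v a = left_limit X e v a"

definition specular_partial :: "'a::euclidean_space set \<Rightarrow> 'a \<Rightarrow> ('a \<Rightarrow> real) \<Rightarrow> 'a \<Rightarrow> real" where
  "specular_partial X e v a = specular_mean (right_derivative X e v a) (left_derivative X e v a)"

text \<open>
  Coordinates are given by the list \<open>es\<close> of the standard basis vectors in order, and a multi-index
  is a list of the same length, so the derivatives in the last variable are taken first.
\<close>

fun specular_multi ::
    "'a::euclidean_space set \<Rightarrow> 'a list \<Rightarrow> nat list \<Rightarrow> ('a \<Rightarrow> real) \<Rightarrow> ('a \<Rightarrow> real)" where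
  "specular_multi X (e # es) (k # ks) v = (specular_partial X e ^^ k) (specular_multi X es ks v)"
| "specular_multi X _ _ v = v"

fun specular_multi_exists ::
    "'a::euclidean_space set \<Rightarrow> 'a list \<Rightarrow> nat list \<Rightarrow> ('a \<Rightarrow> real) \<Rightarrow> bool" where
  "specular_multi_exists X (e # es) (k # ks) v \<longleftrightarrow>
     specular_multi_exists X es ks v \<and>
     (\<forall>j<k. \<forall>a\<in>X. specularly_partial_differentiable X e
        ((specular_partial X e ^^ j) (specular_multi X es ks v)) a)"
| "specular_multi_exists X _ _ v \<longleftrightarrow> True"

definition affine_hyperplane_graph :: "'a::euclidean_space set \<Rightarrow> 'a set \<Rightarrow> bool" where
  "affine_hyperplane_graph X G \<longleftrightarrow> (\<exists>c b. c \<noteq> 0 \<and> G = {x \<in> X. c \<bullet> x = b})"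

definition singular_hyperplane_graph ::
    "'a::euclidean_space set \<Rightarrow> ('a \<Rightarrow> real) \<Rightarrow> 'a set \<Rightarrow> bool" where
  "singular_hyperplane_graph X v G \<longleftrightarrow>
     (\<exists>Y. Y \<subseteq> X \<and> connected Y \<and> affine_hyperplane_graph Y G) \<and>
     (\<exists>e\<in>Basis. \<forall>x\<in>G. one_sided_limits_exist X e v x \<and> left_limit X e v x \<noteq> right_limit X e v x)"

text \<open>
  The singular hyperplanes are collected in a finite set of graphs rather than in a list: a repeated
  hyperplane would make the continuity condition on its graph void.
\<close>

definition piecewise_continuous :: "'a::euclidean_space set \<Rightarrow> ('a \<Rightarrow> real) \<Rightarrow> bool" where
  "piecewise_continuous X v \<longleftrightarrow>
     (\<exists>\<H>. finite \<H> \<and> (\<forall>G\<in>\<H>. singular_hyperplane_graph X v G) \<and>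
        continuous_on (X - \<Union>\<H>) v \<and>
        (\<forall>G\<in>\<H>. continuous_on (G - \<Union>(\<H> - {G})) v))"

definition S0 :: "'a::euclidean_space set \<Rightarrow> ('a \<Rightarrow> real) set" where
  "S0 X = {v. piecewise_continuous X v \<and>
     (\<forall>a\<in>X. \<forall>e\<in>Basis. one_sided_limits_exist X e v a \<and>
        v a = specular_mean (left_limit X e v a) (right_limit X e v a))}"

text \<open>The order \<open>k\<close> is meant to be positive; \<open>|\<alpha>| \<le> k - 2\<close> is over the integers.\<close>

definition S_space :: "'a::euclidean_space list \<Rightarrow> nat \<Rightarrow> 'a set \<Rightarrow> ('a \<Rightarrow> real) set" where
  "S_space es k X = {v. continuous_on X v \<and>
     (\<forall>\<alpha>. length \<alpha> = length es \<longrightarrow> sum_list \<alpha> \<le> k \<longrightarrow>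
        specular_multi_exists X es \<alpha> v \<and> specular_multi X es \<alpha> v \<in> S0 X) \<and>
     (\<forall>\<alpha>. length \<alpha> = length es \<longrightarrow> sum_list \<alpha> + 2 \<le> k \<longrightarrow>
        (\<forall>i\<in>set es. \<forall>j\<in>set es. i \<noteq> j \<longrightarrow>
           (let w = specular_multi X es \<alpha> v in
             (\<forall>a\<in>X. specularly_partial_differentiable X i w a) \<and>
             (\<forall>a\<in>X. specularly_partial_differentiable X j (specular_partial X i w) a) \<and>
             continuous_on X (specular_partial X j (specular_partial X i w)))))}"

definition phototangent :: "'a::euclidean_space set \<Rightarrow> 'a \<Rightarrow> ('a \<Rightarrow> real) \<Rightarrow> 'a \<Rightarrow> ('a \<times> real) set" where
  "phototangent X e v a = range (\<lambda>h. (a + h *\<^sub>R e,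
     if h < 0 then left_derivative X e v a * h + left_limit X e v a
     else if h = 0 then mid_limit X e v a
     else right_derivative X e v a * h + right_limit X e v a))"

definition sphere_points :: "'a::euclidean_space set \<Rightarrow> ('a \<Rightarrow> real) \<Rightarrow> 'a \<Rightarrow> ('a \<times> real) set" where
  "sphere_points X v a =
     (\<Union>e\<in>{e\<in>Basis. specularly_partial_differentiable X e v a}.
        phototangent X e v a \<inter> sphere (a, mid_limit X e v a) 1)"

text \<open>Points of the plane are pairs \<open>(x, t)\<close>.\<close>

definition e\<^sub>x :: "real \<times> real" where "e\<^sub>x = (1, 0)"
definition e\<^sub>t :: "real \<times> real" where "e\<^sub>t = (0, 1)"

definition specularly_differentiable ::
    "(real \<times> real) set \<Rightarrow> (real \<times> real \<Rightarrow> real) \<Rightarrow> real \<times> real \<Rightarrow> bool" where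
  "specularly_differentiable X v a \<longleftrightarrow>
     card (sphere_points X v a) = 4 \<and> mid_limit X e\<^sub>x v a = mid_limit X e\<^sub>t v a"

definition strong_specular_tangent_hyperplane ::
    "(real \<times> real) set \<Rightarrow> (real \<times> real \<Rightarrow> real) \<Rightarrow> real \<times> real \<Rightarrow> ((real \<times> real) \<times> real) set \<Rightarrow> bool"
  where
  "strong_specular_tangent_hyperplane X v a T \<longleftrightarrow>
     specularly_differentiable X v a \<and> affine_hyperplane_graph UNIV T \<and> sphere_points X v a \<subseteq> T"

definition closed_half_plane :: "(real \<times> real) set" where
  "closed_half_plane = UNIV \<times> {0..}"

definition S_line :: "nat \<Rightarrow> (real \<Rightarrow> real) set" where
  "S_line k = S_space [1] k UNIV"

definition S_half_plane :: "nat \<Rightarrow> (real \<times> real \<Rightarrow> real) set" where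
  "S_half_plane k = S_space [e\<^sub>x, e\<^sub>t] k closed_half_plane"

text \<open>Classical partial derivatives, one-sided where \<open>X\<close> contains only one side of \<open>a\<close>.\<close>

definition has_partial ::
    "'a::euclidean_space set \<Rightarrow> 'a \<Rightarrow> ('a \<Rightarrow> real) \<Rightarrow> 'a \<Rightarrow> real \<Rightarrow> bool" where
  "has_partial X e v a d \<longleftrightarrow>
     ((\<lambda>h. v (a + h *\<^sub>R e)) has_real_derivative d) (at 0 within {h. a + h *\<^sub>R e \<in> X})"

definition partial :: "'a::euclidean_space set \<Rightarrow> 'a \<Rightarrow> ('a \<Rightarrow> real) \<Rightarrow> 'a \<Rightarrow> real" where
  "partial X e v a = (THE d. has_partial X e v a d)"

abbreviation u_x :: "(real \<times> real \<Rightarrow> real) \<Rightarrow> real \<times> real \<Rightarrow> real" where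
  "u_x u \<equiv> partial closed_half_plane e\<^sub>x u"

abbreviation u_t :: "(real \<times> real \<Rightarrow> real) \<Rightarrow> real \<times> real \<Rightarrow> real" where
  "u_t u \<equiv> partial closed_half_plane e\<^sub>t u"

text \<open>Solving the equation includes the existence of all derivatives that occur in it.\<close>

definition solves_wave_ivp ::
    "(real \<Rightarrow> real) \<Rightarrow> (real \<Rightarrow> real) \<Rightarrow> (real \<times> real \<Rightarrow> real) \<Rightarrow> bool" where
  "solves_wave_ivp \<phi> \<psi> u \<longleftrightarrow>
     (\<forall>p \<in> UNIV \<times> {0<..}.
        (\<exists>d. has_partial closed_half_plane e\<^sub>t u p d) \<and>
        (\<exists>d. has_partial closed_half_plane e\<^sub>x u p d) \<and>
        specularly_partial_differentiable closed_half_plane e\<^sub>t (u_t u) p \<and>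
        specularly_partial_differentiable closed_half_plane e\<^sub>x (u_x u) p \<and>
        specular_partial closed_half_plane e\<^sub>t (u_t u) p
          - specular_partial closed_half_plane e\<^sub>x (u_x u) p = 0) \<and>
     (\<forall>x. u (x, 0) = \<phi> x) \<and>
     (\<forall>x. has_partial closed_half_plane e\<^sub>t u (x, 0) (\<psi> x))"

end

theory Submission
  imports Defs
begin

text \<open>
  A specular mean is a weighted arithmetic mean of the two one-sided derivatives, so a first-crossing
  argument gives a mean value inequality, and a function whose specular derivative is continuous is
  classically differentiable.  The mixed specular derivatives of \<open>u\<close> are continuous by definition
  of \<open>S\<^sup>2\<close>; hence \<open>u\<^sub>t\<close> and \<open>u\<^sub>x\<close> are continuous up to \<open>t = 0\<close>, the mixed derivatives are classical
  and they agree.  Off the finitely many singular lines of \<open>\<partial>\<^sup>S\<^sub>t u\<^sub>t = \<partial>\<^sup>S\<^sub>x u\<^sub>x\<close> the pure second derivatives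
  are classical too, so \<open>u\<^sub>t - u\<^sub>x\<close> has derivative \<open>0\<close> along the characteristics \<open>x - t = const\<close>.  Being
  continuous, it is constant along them, also across the singular lines, and a second integration,
  along \<open>x + t = const\<close>, gives d'Alembert's formula.
\<close>

section \<open>Specular derivatives in one variable\<close>

text \<open>The quotients use the value \<open>f x\<close> where the half-plane notions use
  one-sided limits, so continuity at \<open>x\<close> is built in. For members of \<open>S0\<close>
  the two versions agree, because their value at a point with equal one-sided limits is that
  limit.\<close>

definition has_specular_derivative :: "(real \<Rightarrow> real) \<Rightarrow> real \<Rightarrow> real \<Rightarrow> bool" where
  "has_specular_derivative f d x \<longleftrightarrow> (\<exists>\<alpha> \<beta>.
     ((\<lambda>h. (f (x + h) - f x) / h) \<longlongrightarrow> \<alpha>) (at_right 0) \<and>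
     ((\<lambda>h. (f (x + h) - f x) / h) \<longlongrightarrow> \<beta>) (at_left 0) \<and> d = specular_mean \<alpha> \<beta>)"

text \<open>The weights are positive, which makes order bounds and the behaviour under sign change
  immediate. Cross-multiplying reduces the identity to p^2 = \<alpha>^2 + 1 and q^2 = \<beta>^2 + 1;
  in the exceptional case \<beta> = -\<alpha> the two roots coincide and the numerator
  vanishes.\<close>

lemma specular_mean_weighted:
  "specular_mean \<alpha> \<beta> =
     (\<alpha> * sqrt (\<beta>\<^sup>2 + 1) + \<beta> * sqrt (\<alpha>\<^sup>2 + 1)) / (sqrt (\<alpha>\<^sup>2 + 1) + sqrt (\<beta>\<^sup>2 + 1))"
proof -
  define p q where "p = sqrt (\<alpha>\<^sup>2 + 1)" and "q = sqrt (\<beta>\<^sup>2 + 1)"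
  have pq: "p > 0" "q > 0"
    unfolding p_def q_def by (simp_all add: add_nonneg_pos)
  have p2: "p\<^sup>2 = \<alpha>\<^sup>2 + 1" and q2: "q\<^sup>2 = \<beta>\<^sup>2 + 1"
    unfolding p_def q_def by simp_all
  show ?thesis
  proof (cases "\<alpha> + \<beta> = 0")
    case True
    then have "\<beta> = - \<alpha>" by simp
    then show ?thesis by (simp add: specular_mean_def)
  next
    case False
    have "(\<alpha> * \<beta> - 1 + p * q) * (p + q) = (\<alpha> * q + \<beta> * p) * (\<alpha> + \<beta>)"
    proof -
      have "p * p * q = (\<alpha> * \<alpha> + 1) * q" "q * q * p = (\<beta> * \<beta> + 1) * p"
        using p2 q2 by (simp_all add: power2_eq_square)
      then show ?thesis by (simp add: algebra_simps)
    qed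
    then have "(\<alpha> * \<beta> - 1 + p * q) / (\<alpha> + \<beta>) = (\<alpha> * q + \<beta> * p) / (p + q)"
      using False pq by (simp add: frac_eq_eq)
    then show ?thesis
      using False by (simp add: specular_mean_def real_sqrt_mult p_def q_def)
  qed
qed

lemma specular_mean_ge:
  assumes "k \<le> \<alpha>" "k \<le> \<beta>"
  shows "k \<le> specular_mean \<alpha> \<beta>"
proof -
  define p q where "p = sqrt (\<alpha>\<^sup>2 + 1)" and "q = sqrt (\<beta>\<^sup>2 + 1)"
  have pq: "p > 0" "q > 0"
    unfolding p_def q_def by (simp_all add: add_nonneg_pos)
  have "k * (p + q) \<le> \<alpha> * q + \<beta> * p"
    using mult_right_mono[OF assms(1) less_imp_le[OF pq(2)]]
      mult_right_mono[OF assms(2) less_imp_le[OF pq(1)]]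
    by (simp add: algebra_simps)
  then show ?thesis
    using pq unfolding specular_mean_weighted p_def[symmetric] q_def[symmetric]
    by (simp add: pos_le_divide_eq)
qed

lemma specular_mean_uminus: "specular_mean (- \<alpha>) (- \<beta>) = - specular_mean \<alpha> \<beta>"
  unfolding specular_mean_weighted minus_divide_left
  by (rule arg_cong2[where f = "(/)"]) simp_all

lemma specular_mean_same [simp]: "specular_mean \<alpha> \<alpha> = \<alpha>"
proof -
  have "sqrt (\<alpha>\<^sup>2 + 1) > 0" by (simp add: add_nonneg_pos)
  then show ?thesis by (simp add: specular_mean_weighted)
qed

lemma has_specular_derivative_uminus:
  assumes "has_specular_derivative f d x"
  shows "has_specular_derivative (\<lambda>x. - f x) (- d) x"
proof -
  obtain \<alpha> \<beta> where
    r: "((\<lambda>h. (f (x + h) - f x) / h) \<longlongrightarrow> \<alpha>) (at_right 0)" and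
    l: "((\<lambda>h. (f (x + h) - f x) / h) \<longlongrightarrow> \<beta>) (at_left 0)" and d: "d = specular_mean \<alpha> \<beta>"
    using assms by (auto simp: has_specular_derivative_def)
  have eq: "(\<lambda>h. (- f (x + h) - - f x) / h) = (\<lambda>h. - ((f (x + h) - f x) / h))"
    by (simp only: minus_divide_left minus_diff_minus)
  show ?thesis
    unfolding has_specular_derivative_def eq
    using tendsto_minus[OF r] tendsto_minus[OF l] d
    by (intro exI[of _ "- \<alpha>"] exI[of _ "- \<beta>"]) (simp add: specular_mean_uminus)
qed

lemma has_specular_derivative_isCont:
  assumes "has_specular_derivative f d x"
  shows "isCont f x"
proof -
  obtain \<alpha> \<beta> where
    r: "((\<lambda>h. (f (x + h) - f x) / h) \<longlongrightarrow> \<alpha>) (at_right 0)" and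
    l: "((\<lambda>h. (f (x + h) - f x) / h) \<longlongrightarrow> \<beta>) (at_left 0)"
    using assms by (auto simp: has_specular_derivative_def)
  have *: "((\<lambda>h. f (x + h)) \<longlongrightarrow> f x) (at 0 within A)"
    if "((\<lambda>h. (f (x + h) - f x) / h) \<longlongrightarrow> c) (at 0 within A)" for c A
  proof -
    have "((\<lambda>h. f x + h * ((f (x + h) - f x) / h)) \<longlongrightarrow> f x + 0 * c) (at 0 within A)"
      by (intro tendsto_intros that)
    moreover have "\<forall>\<^sub>F h in at 0 within A. f x + h * ((f (x + h) - f x) / h) = f (x + h)"
      by (auto simp: eventually_at_filter)
    ultimately show ?thesis
      using tendsto_cong by force
  qed
  show ?thesis
    using *[OF r] *[OF l] by (simp add: isCont_iff filterlim_split_at)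
qed

text \<open>Where the graph first rises above a chord of slope \<open>k > K\<close>, both one-sided derivatives are at least \<open>k\<close>.\<close>

lemma specular_mean_value_le:
  assumes "a \<le> b" and cont: "continuous_on {a..b} f"
    and deriv: "\<And>x. a < x \<Longrightarrow> x < b \<Longrightarrow> has_specular_derivative f (g x) x"
    and bound: "\<And>x. a < x \<Longrightarrow> x < b \<Longrightarrow> g x \<le> K"
  shows "f b - f a \<le> K * (b - a)"
proof (rule ccontr)
  assume neg: "\<not> f b - f a \<le> K * (b - a)"
  then have ab: "a < b" using \<open>a \<le> b\<close> by (cases "a = b") auto
  obtain k where k: "K < k" "k < (f b - f a) / (b - a)"
    using neg ab dense[of K "(f b - f a) / (b - a)"] by (auto simp: field_simps)
  \<comment> \<open>Subtracting the slope \<open>k\<close> turns the violated inequality into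
    \<open>F a < F b\<close>, which leaves room for an intermediate level \<open>m\<close>.\<close>
  define F where "F x = f x - k * x" for x
  have "F a < F b" using k ab by (simp add: F_def field_simps)
  then obtain m where m: "F a < m" "m < F b" using dense by blast
  have contF: "continuous_on {a..b} F"
    unfolding F_def by (intro continuous_intros cont)
  define S where "S = {x \<in> {a..b}. m < F x}"
  have bS: "b \<in> S" using m ab by (simp add: S_def)
  have bdd: "bdd_below S" unfolding S_def by (rule bdd_belowI[of _ a]) auto
  \<comment> \<open>The first crossing of the level \<open>m\<close>. Continuity will give
    \<open>F c = m\<close>, hence \<open>c\<close> differs from both end points and has a specular
    derivative.\<close>
  define c where "c = Inf S"
  have ca: "a \<le> c" and cb: "c \<le> b"
    using bS bdd unfolding c_def by (auto intro!: cInf_greatest cInf_lower simp: S_def)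
  have below: "F x \<le> m" if "a \<le> x" "x < c" for x
  proof (rule ccontr)
    assume "\<not> F x \<le> m"
    then have "x \<in> S" using that cb by (simp add: S_def)
    then show False using cInf_lower[OF _ bdd] that by (fastforce simp: c_def)
  qed
  have near: "\<exists>y\<in>S. y < c + d" if "d > 0" for d
    using cInf_lessD[of S "c + d"] bS that unfolding c_def by auto
  have contc: "\<forall>e>0. \<exists>d>0. \<forall>y\<in>{a..b}. \<bar>y - c\<bar> < d \<longrightarrow> \<bar>F y - F c\<bar> < e"
    using contF ca cb unfolding continuous_on_iff dist_real_def by simp
  have le: "F c \<le> m"
  proof (rule ccontr)
    assume "\<not> F c \<le> m"
    then obtain d where d: "d > 0" "\<forall>y\<in>{a..b}. \<bar>y - c\<bar> < d \<longrightarrow> \<bar>F y - F c\<bar> < F c - m"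
      using contc by (metis diff_gt_0_iff_gt not_le)
    have "a < c" using ca \<open>\<not> F c \<le> m\<close> m by (cases "a = c") auto
    define y where "y = max a (c - d / 2)"
    have y: "a \<le> y" "y < c" "\<bar>y - c\<bar> < d" using d \<open>a < c\<close> by (auto simp: y_def)
    then have "F y > m" using d(2) cb by fastforce
    then show False using below y by fastforce
  qed
  have ge: "m \<le> F c"
  proof (rule ccontr)
    assume "\<not> m \<le> F c"
    then obtain d where d: "d > 0" "\<forall>y\<in>{a..b}. \<bar>y - c\<bar> < d \<longrightarrow> \<bar>F y - F c\<bar> < m - F c"
      using contc by (metis diff_gt_0_iff_gt not_le)
    obtain y where y: "y \<in> S" "y < c + d" using near d by blast
    have "c \<le> y" using y(1) bdd unfolding c_def by (rule cInf_lower)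
    then have "\<bar>F y - F c\<bar> < m - F c"
      using d(2)[rule_format, of y] y by (simp add: S_def)
    then have "F y < m" by linarith
    then show False using y by (simp add: S_def)
  qed
  have c: "F c = m" using le ge by simp
  then have acb: "a < c" "c < b" using m ca cb by (auto simp: less_le)
  obtain \<alpha> \<beta> where
    r: "((\<lambda>h. (f (c + h) - f c) / h) \<longlongrightarrow> \<alpha>) (at_right 0)" and
    l: "((\<lambda>h. (f (c + h) - f c) / h) \<longlongrightarrow> \<beta>) (at_left 0)" and g: "g c = specular_mean \<alpha> \<beta>"
    using deriv[OF acb] by (auto simp: has_specular_derivative_def)
  \<comment> \<open>Left of \<open>c\<close> the function \<open>F\<close> stays at or below
    \<open>F c\<close>; dividing by a negative increment reverses the inequality.\<close>
  have "k \<le> \<beta>"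
  proof (rule tendsto_lowerbound[OF l])
    have "\<forall>\<^sub>F h in at_left 0. a - c < h \<and> h < (0::real)"
      using eventually_at_left_real[of "a - c" 0] acb by (auto elim: eventually_mono)
    then show "\<forall>\<^sub>F h in at_left 0. k \<le> (f (c + h) - f c) / h"
    proof (rule eventually_mono)
      fix h assume h: "a - c < h \<and> h < 0"
      have "F (c + h) \<le> F c" using below[of "c + h"] h c by simp
      then show "k \<le> (f (c + h) - f c) / h"
        using h by (simp add: F_def neg_le_divide_eq algebra_simps)
    qed
  qed simp
  \<comment> \<open>Otherwise \<open>F\<close> would lie below \<open>m\<close> just to the right of
    \<open>c\<close>, whereas points of \<open>S\<close> accumulate there, \<open>c\<close> itself
    not being in \<open>S\<close>.\<close>
  moreover have "k \<le> \<alpha>"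
  proof (rule ccontr)
    assume "\<not> k \<le> \<alpha>"
    then have "\<forall>\<^sub>F h in at_right 0. (f (c + h) - f c) / h < k"
      using order_tendstoD(2)[OF r] by simp
    then obtain d where d: "d > 0" "\<And>h. 0 < h \<Longrightarrow> h < d \<Longrightarrow> (f (c + h) - f c) / h < k"
      by (auto simp: eventually_at_right_field)
    obtain y where y: "y \<in> S" "y < c + d" using near d by blast
    have "c \<le> y" using y(1) bdd unfolding c_def by (rule cInf_lower)
    moreover have "y \<noteq> c" using y c by (auto simp: S_def)
    ultimately have "(f (c + (y - c)) - f c) / (y - c) < k" "y > c" using d(2)[of "y - c"] y by auto
    then have "F y < F c" by (simp add: F_def pos_divide_less_eq algebra_simps)
    then show False using y c by (simp add: S_def)
  qed
  ultimately have "k \<le> g c" using g specular_mean_ge by simp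
  then show False using bound[OF acb] k by simp
qed

lemma specular_mean_value_ge:
  assumes "a \<le> b" and cont: "continuous_on {a..b} f"
    and deriv: "\<And>x. a < x \<Longrightarrow> x < b \<Longrightarrow> has_specular_derivative f (g x) x"
    and bound: "\<And>x. a < x \<Longrightarrow> x < b \<Longrightarrow> K \<le> g x"
  shows "K * (b - a) \<le> f b - f a"
proof -
  have "- f b - - f a \<le> - K * (b - a)"
    using assms by (intro specular_mean_value_le[where g = "\<lambda>x. - g x"])
      (simp_all add: has_specular_derivative_uminus continuous_on_minus)
  then show ?thesis by simp
qed

text \<open>The two one-sided inequalities with bounds \<open>c + K\<close> and
  \<open>c - K\<close>. Segments replace intervals so that \<open>b\<close> may lie on either side
  of \<open>a\<close>, as two-sided difference quotients require.\<close>

lemma specular_mean_value_abs: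
  assumes "continuous_on (closed_segment a b) f"
    and deriv: "\<And>x. x \<in> open_segment a b \<Longrightarrow> has_specular_derivative f (g x) x"
    and bound: "\<And>x. x \<in> open_segment a b \<Longrightarrow> \<bar>g x - c\<bar> \<le> K"
  shows "\<bar>f b - f a - c * (b - a)\<bar> \<le> K * \<bar>b - a\<bar>"
proof (cases "a \<le> b")
  case True
  then have sub: "f b - f a \<le> (c + K) * (b - a)" "(c - K) * (b - a) \<le> f b - f a"
    using assms by (auto intro!: specular_mean_value_le specular_mean_value_ge
        simp: closed_segment_eq_real_ivl open_segment_eq_real_ivl abs_le_iff)
      (fastforce simp: abs_le_iff open_segment_eq_real_ivl)+
  then show ?thesis using True by (simp add: abs_le_iff algebra_simps)
next
  case False
  then have sub: "f a - f b \<le> (c + K) * (a - b)" "(c - K) * (a - b) \<le> f a - f b"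
    using assms by (auto intro!: specular_mean_value_le specular_mean_value_ge
        simp: closed_segment_eq_real_ivl open_segment_eq_real_ivl abs_le_iff)
      (fastforce simp: abs_le_iff open_segment_eq_real_ivl)+
  then show ?thesis using False by (simp add: abs_le_iff algebra_simps)
qed

text \<open>Close to \<open>x\<close> the values of \<open>g\<close> differ little from
  \<open>g x\<close>, and the mean value inequality with \<open>c = g x\<close> carries this over to
  the difference quotients of \<open>f\<close>.\<close>

lemma has_specular_derivative_imp_DERIV:
  assumes "open S" "x \<in> S"
    and deriv: "\<And>y. y \<in> S \<Longrightarrow> has_specular_derivative f (g y) y"
    and "isCont g x"
  shows "(f has_real_derivative g x) (at x)"
  unfolding has_field_derivative_iff tendsto_iff dist_real_def
proof (intro allI impI)
  fix e :: real assume e: "e > 0"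
  obtain d1 where d1: "d1 > 0" "ball x d1 \<subseteq> S"
    using assms(1,2) open_contains_ball by blast
  obtain d2 where d2: "d2 > 0" "\<And>y. \<bar>y - x\<bar> < d2 \<Longrightarrow> \<bar>g y - g x\<bar> < e / 2"
    using \<open>isCont g x\<close> e unfolding continuous_at_eps_delta dist_real_def
    by (metis half_gt_zero)
  show "\<forall>\<^sub>F y in at x. \<bar>(f y - f x) / (y - x) - g x\<bar> < e"
    unfolding eventually_at
  proof (intro exI[of _ "min d1 d2"] conjI ballI impI)
    fix y assume y: "y \<noteq> x \<and> dist y x < min d1 d2"
    have seg: "\<bar>z - x\<bar> < min d1 d2" if "z \<in> closed_segment x y" for z
      using that y by (auto simp: closed_segment_eq_real_ivl dist_real_def split: if_splits)
    have inS: "z \<in> S" if "z \<in> closed_segment x y" for z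
      using seg[OF that] d1(2) by (auto simp: dist_real_def abs_minus_commute subset_iff)
    have oc: "z \<in> closed_segment x y" if "z \<in> open_segment x y" for z
      using that by (simp add: open_segment_def)
    have "\<bar>f y - f x - g x * (y - x)\<bar> \<le> e / 2 * \<bar>y - x\<bar>"
    proof (rule specular_mean_value_abs[where g = g])
      show "continuous_on (closed_segment x y) f"
        using deriv inS has_specular_derivative_isCont
        by (metis continuous_at_imp_continuous_on)
      show "has_specular_derivative f (g z) z" if "z \<in> open_segment x y" for z
        using deriv inS oc[OF that] by blast
      show "\<bar>g z - g x\<bar> \<le> e / 2" if "z \<in> open_segment x y" for z
        using d2(2)[of z] seg[OF oc[OF that]] by simp
    qed
    also have "\<dots> < e * \<bar>y - x\<bar>" using y e by simp
    finally have "\<bar>(f y - f x - g x * (y - x)) / (y - x)\<bar> < e"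
      using y by (simp add: abs_divide pos_divide_less_eq)
    then show "\<bar>(f y - f x) / (y - x) - g x\<bar> < e"
      using y by (simp add: diff_divide_distrib)
  qed (use d1 d2 in auto)
qed

section \<open>Classical solutions off finitely many lines\<close>

lemma closed_finite_hyperplanes:
  fixes C :: "('a::real_inner \<times> real) set"
  assumes "finite C"
  shows "closed {z. \<exists>(c, b)\<in>C. c \<bullet> z = b}"
proof -
  have "{z. \<exists>(c, b)\<in>C. c \<bullet> z = b} = (\<Union>(c, b)\<in>C. {z. c \<bullet> z = b})" by auto
  moreover have "closed (\<Union>(c, b)\<in>C. {z. c \<bullet> z = b})"
    using assms by (intro closed_UN) (auto intro: closed_hyperplane)
  ultimately show ?thesis by simp
qed

lemma open_contains_box:
  fixes S :: "(real \<times> real) set"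
  assumes "open S" "(x, t) \<in> S"
  obtains r where "r > 0" "{x - r<..<x + r} \<times> {t - r<..<t + r} \<subseteq> S"
proof -
  obtain A B where AB: "open A" "open B" "(x, t) \<in> A \<times> B" "A \<times> B \<subseteq> S"
    using assms by (rule open_prod_elim)
  obtain a where a: "a > 0" "ball x a \<subseteq> A" using AB(1,3) by (auto simp: open_contains_ball)
  obtain b where b: "b > 0" "ball t b \<subseteq> B" using AB(2,3) by (auto simp: open_contains_ball)
  show thesis
  proof (rule that[of "min a b"])
    have "{x - min a b<..<x + min a b} \<subseteq> ball x a" "{t - min a b<..<t + min a b} \<subseteq> ball t b"
      by (auto simp: dist_real_def)
    then have "{x - min a b<..<x + min a b} \<times> {t - min a b<..<t + min a b} \<subseteq> A \<times> B"
      using a(2) b(2) by (intro Sigma_mono) (auto intro: subset_trans)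
    then show "{x - min a b<..<x + min a b} \<times> {t - min a b<..<t + min a b} \<subseteq> S"
      using AB(4) by (rule subset_trans)
  qed (use a b in simp)
qed

text \<open>Schwarz's theorem. The second difference of \<open>u\<close> over a small square is, by
  two applications of the mean value theorem in either order, the area times a value of
  \<open>m\<close> and also the area times a value of \<open>n\<close>.\<close>

lemma mixed_partials_eq:
  fixes u p q m n :: "real \<times> real \<Rightarrow> real"
  assumes S: "open S" "(x, t) \<in> S"
    and p: "\<And>y s. (y, s) \<in> S \<Longrightarrow> ((\<lambda>z. u (y, z)) has_real_derivative p (y, s)) (at s)"
    and q: "\<And>y s. (y, s) \<in> S \<Longrightarrow> ((\<lambda>z. u (z, s)) has_real_derivative q (y, s)) (at y)"
    and m: "\<And>y s. (y, s) \<in> S \<Longrightarrow> ((\<lambda>z. p (z, s)) has_real_derivative m (y, s)) (at y)"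
    and n: "\<And>y s. (y, s) \<in> S \<Longrightarrow> ((\<lambda>z. q (y, z)) has_real_derivative n (y, s)) (at s)"
    and cm: "continuous_on S m" and cn: "continuous_on S n"
  shows "m (x, t) = n (x, t)"
proof (rule ccontr)
  assume neq: "m (x, t) \<noteq> n (x, t)"
  define e where "e = \<bar>m (x, t) - n (x, t)\<bar> / 2"
  \<comment> \<open>With \<open>e\<close> half the gap, no value of \<open>m\<close> on
    \<open>S'\<close> can equal a value of \<open>n\<close> on \<open>S'\<close>.\<close>
  define S' where "S' = {z \<in> S. \<bar>m z - m (x, t)\<bar> < e \<and> \<bar>n z - n (x, t)\<bar> < e}"
  have "open ((\<lambda>z. (m z, n z)) -` ({m (x, t) - e<..<m (x, t) + e} \<times> {n (x, t) - e<..<n (x, t) + e}) \<inter> S)"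
    using S cm cn by (intro continuous_on_open_vimage[THEN iffD1, rule_format] continuous_on_Pair open_Times) auto
  also have "((\<lambda>z. (m z, n z)) -` ({m (x, t) - e<..<m (x, t) + e} \<times> {n (x, t) - e<..<n (x, t) + e}) \<inter> S) = S'"
    unfolding S'_def by (auto simp: abs_less_iff)
  finally have "open S'" .
  moreover have "(x, t) \<in> S'" using S neq by (simp add: S'_def e_def)
  ultimately obtain r where r: "r > 0" "{x - r<..<x + r} \<times> {t - r<..<t + r} \<subseteq> S'"
    by (rule open_contains_box)
  define h where "h = r / 2"
  have h: "h > 0" using r by (simp add: h_def)
  have box: "(y, s) \<in> S'" if "x \<le> y" "y \<le> x + h" "t \<le> s" "s \<le> t + h" for y s
    using r that by (intro subsetD[OF r(2)]) (auto simp: h_def)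
  then have boxS: "(y, s) \<in> S" if "x \<le> y" "y \<le> x + h" "t \<le> s" "s \<le> t + h" for y s
    using that by (auto simp: S'_def)
  \<comment> \<open>First read as the increment in t of an x-difference, which leads to
    \<open>m\<close>; further down regrouped as the increment in x of a t-difference, which leads to
    \<open>n\<close>.\<close>
  define D where "D = u (x + h, t + h) - u (x, t + h) - u (x + h, t) + u (x, t)"
  have "\<exists>s. t < s \<and> s < t + h \<and> (u (x + h, t + h) - u (x, t + h)) - (u (x + h, t) - u (x, t))
      = (t + h - t) * (p (x + h, s) - p (x, s))"
    using h by (intro MVT2 derivative_intros p boxS) auto
  then obtain s where s: "t < s" "s < t + h" "D = h * (p (x + h, s) - p (x, s))"
    by (auto simp: D_def algebra_simps)
  have "\<exists>y. x < y \<and> y < x + h \<and> p (x + h, s) - p (x, s) = (x + h - x) * m (y, s)"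
    using h s by (intro MVT2 m boxS) auto
  then obtain y where y: "x < y" "y < x + h" "D = h * (h * m (y, s))"
    using s(3) by auto
  have "\<exists>y. x < y \<and> y < x + h \<and> (u (x + h, t + h) - u (x + h, t)) - (u (x, t + h) - u (x, t))
      = (x + h - x) * (q (y, t + h) - q (y, t))"
    using h by (intro MVT2 derivative_intros q boxS) auto
  then obtain y' where y': "x < y'" "y' < x + h" "D = h * (q (y', t + h) - q (y', t))"
    by (auto simp: D_def algebra_simps)
  have "\<exists>s. t < s \<and> s < t + h \<and> q (y', t + h) - q (y', t) = (t + h - t) * n (y', s)"
    using h y' by (intro MVT2 n boxS) auto
  then obtain s' where s': "t < s'" "s' < t + h" "D = h * (h * n (y', s'))"
    using y'(3) by auto
  have "m (y, s) = n (y', s')" using y(3) s'(3) h by simp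
  moreover have "\<bar>m (y, s) - m (x, t)\<bar> < e" using box[of y s] y s by (simp add: S'_def)
  moreover have "\<bar>n (y', s') - n (x, t)\<bar> < e" using box[of y' s'] y' s' by (simp add: S'_def)
  moreover have "\<bar>m (x, t) - n (x, t)\<bar> = 2 * e" by (simp add: e_def)
  ultimately show False by linarith
qed

text \<open>Chain rule along a curve through \<open>(x, t)\<close>. Total differentiability at that
  point comes from the asymmetric criterion: one partial derivative at the point, the other one
  nearby and continuous.\<close>

lemma DERIV_along_line:
  fixes w wt :: "real \<times> real \<Rightarrow> real" and wx :: real
  assumes S: "open S" "(x, t) \<in> S"
    and wx: "((\<lambda>z. w (z, t)) has_real_derivative wx) (at x)"
    and wt: "\<And>y s. (y, s) \<in> S \<Longrightarrow> ((\<lambda>z. w (y, z)) has_real_derivative wt (y, s)) (at s)"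
    and cont: "continuous_on S wt"
    and "(f has_real_derivative f') (at r)" "(g has_real_derivative g') (at r)"
    and "f r = x" "g r = t"
  shows "((\<lambda>s. w (f s, g s)) has_real_derivative wx * f' + wt (x, t) * g') (at r)"
proof -
  obtain d where d: "d > 0" "{x - d<..<x + d} \<times> {t - d<..<t + d} \<subseteq> S"
    using open_contains_box[OF S] .
  define I J where "I = {x - d<..<x + d}" and "J = {t - d<..<t + d}"
  have IJ: "open (I \<times> J)" "(x, t) \<in> I \<times> J" "I \<times> J \<subseteq> S"
    using d by (simp_all add: I_def J_def open_Times)
  note mult_right = blinfun_mult_right.rep_eq[where 'a = real]
  \<comment> \<open>The criterion \<open>has_derivative_partialsI\<close> takes the second partial
    derivative as a map into the bounded linear operators, whence \<open>blinfun_mult_right\<close>;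
    the box provides the convex fibre \<open>J\<close>.\<close>
  have "((\<lambda>(y, s). w (y, s)) has_derivative
      (\<lambda>(y, s). wx * y + blinfun_apply (blinfun_mult_right (wt (x, t))) s)) (at (x, t) within I \<times> J)"
  proof (rule has_derivative_partialsI)
    show "((\<lambda>z. w (z, t)) has_derivative (*) wx) (at x within I)"
      by (rule has_derivative_at_withinI[OF wx[unfolded has_field_derivative_def]])
    show "((\<lambda>z. w (y, z)) has_derivative blinfun_apply (blinfun_mult_right (wt (y, s)))) (at s within J)"
      if "y \<in> I" "s \<in> J" for y s
    proof -
      have "(y, s) \<in> S" using that IJ(3) by auto
      then have "((\<lambda>z. w (y, z)) has_derivative (*) (wt (y, s))) (at s within J)"
        by (rule has_derivative_at_withinI[OF wt[unfolded has_field_derivative_def]])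
      then show ?thesis unfolding mult_right .
    qed
    have "continuous (at (x, t) within I \<times> J) wt"
      using continuous_on_subset[OF cont IJ(3)] IJ(2)
      by (simp only: continuous_on_eq_continuous_within)
    then have "continuous (at (x, t) within I \<times> J) (\<lambda>z. blinfun_mult_right (wt z))"
      by (rule bounded_linear.continuous[OF bounded_linear_blinfun_mult_right])
    then show "continuous (at (x, t) within I \<times> J) (\<lambda>(y, s). blinfun_mult_right (wt (y, s)))"
      by (simp add: case_prod_unfold)
    show "t \<in> J" "convex J" using IJ(2) by (simp_all add: J_def)
  qed
  then have "(w has_derivative (\<lambda>z. wx * fst z + wt (x, t) * snd z)) (at (f r, g r))"
    unfolding at_within_open[OF IJ(2,1)] mult_right assms(8,9) by (simp add: case_prod_unfold)
  moreover have "((\<lambda>s. (f s, g s)) has_derivative (\<lambda>h. (f' * h, g' * h))) (at r)"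
    using assms(6,7) unfolding has_field_derivative_def by (rule has_derivative_Pair)
  ultimately have "((\<lambda>s. w (f s, g s)) has_derivative
      (\<lambda>h. wx * fst (f' * h, g' * h) + wt (x, t) * snd (f' * h, g' * h))) (at r)"
    using has_derivative_compose[of "\<lambda>s. (f s, g s)" _ r UNIV w] by blast
  moreover have "(\<lambda>h. wx * fst (f' * h, g' * h) + wt (x, t) * snd (f' * h, g' * h))
      = (*) (wx * f' + wt (x, t) * g')"
    by (simp add: fun_eq_iff distrib_right mult.assoc)
  ultimately show ?thesis
    unfolding has_field_derivative_def by simp
qed

text \<open>A characteristic that is not contained in one of the finitely many lines meets them in finitely
  many points; the remaining characteristics are limits of such ones.\<close>

lemma constant_along_characteristics:
  fixes w :: "real \<times> real \<Rightarrow> real" and C :: "((real \<times> real) \<times> real) set"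
  assumes C: "finite C" "\<And>c b. (c, b) \<in> C \<Longrightarrow> c \<noteq> 0"
    and cont: "continuous_on (UNIV \<times> {0..}) w"
    and deriv: "\<And>x s. s > 0 \<Longrightarrow> (\<And>c b. (c, b) \<in> C \<Longrightarrow> c \<bullet> (x + s, s) \<noteq> b) \<Longrightarrow>
      ((\<lambda>s. w (x + s, s)) has_real_derivative 0) (at s)"
    and "t \<ge> 0"
  shows "w (x + t, t) = w (x, 0)"
proof -
  \<comment> \<open>A line parallel to the characteristics has \<open>fst c + snd c = 0\<close> and
    meets t = 0 at \<open>b / fst c\<close>. The other lines merely add finitely many values, with 0
    for a zero divisor.\<close>
  define Bad where "Bad = (\<lambda>(c, b). b / fst c) ` C"
  have good: "w (x + t, t) = w (x, 0)" if "x \<notin> Bad" for x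
  proof -
    \<comment> \<open>The parameters at which the characteristic from \<open>(x, 0)\<close> crosses
      a line, found by solving \<open>c \<bullet> (x + s, s) = b\<close> for
      \<open>s\<close>.\<close>
    define K where "K = (\<lambda>(c, b). (b - fst c * x) / (fst c + snd c)) ` C"
    have K: "s \<in> K" if "(c, b) \<in> C" "c \<bullet> (x + s, s) = b" for c b s
    proof -
      have eq: "s * (fst c + snd c) = b - fst c * x"
        using that(2) by (cases c) (simp add: algebra_simps)
      have "fst c + snd c \<noteq> 0"
      proof
        assume 0: "fst c + snd c = 0"
        then have "fst c \<noteq> 0" using C(2)[OF that(1)] by (cases c) (auto simp: zero_prod_def)
        moreover have "b = fst c * x" using eq 0 by simp
        ultimately have "x = b / fst c" by simp
        then have "x \<in> Bad" unfolding Bad_def using that(1) by force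
        then show False using \<open>x \<notin> Bad\<close> by simp
      qed
      then have "s = (b - fst c * x) / (fst c + snd c)" using eq by (simp add: eq_divide_eq)
      then show ?thesis unfolding K_def using that(1) by force
    qed
    \<comment> \<open>Continuity of \<open>w\<close> lets the fundamental theorem of calculus
      tolerate the finite exceptional set \<open>K\<close>.\<close>
    have "((\<lambda>s. 0) has_integral w (x + t, t) - w (x + 0, 0)) {0..t}"
    proof (rule fundamental_theorem_of_calculus_interior_strong[where S = K])
      show "finite K" using C by (simp add: K_def)
      show "((\<lambda>s. w (x + s, s)) has_vector_derivative 0) (at s)" if "s \<in> {0<..<t} - K" for s
        using deriv[of s x] K that by (auto simp: has_real_derivative_iff_has_vector_derivative)
      show "continuous_on {0..t} (\<lambda>s. w (x + s, s))"
        by (rule continuous_on_compose2[OF cont]) (auto intro!: continuous_intros)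
    qed (use \<open>t \<ge> 0\<close> in auto)
    then have "w (x + t, t) - w (x + 0, 0) = 0" by (rule has_integral_unique) simp
    then show ?thesis by simp
  qed
  have c1: "continuous_on UNIV (\<lambda>x. w (x + t, t))" "continuous_on UNIV (\<lambda>x. w (x, 0))"
    using \<open>t \<ge> 0\<close> by (auto intro!: continuous_on_compose2[OF cont] continuous_intros)
  \<comment> \<open>The starting points that violate the claim form a set that is open and, being
    part of \<open>Bad\<close>, finite; such a set of reals is empty.\<close>
  then have "open {x. w (x + t, t) \<noteq> w (x, 0)}"
    by (rule open_Collect_neq)
  moreover have "finite {x. w (x + t, t) \<noteq> w (x, 0)}"
  proof (rule finite_subset)
    show "{x. w (x + t, t) \<noteq> w (x, 0)} \<subseteq> Bad" using good by blast
    show "finite Bad" unfolding Bad_def using C(1) by (rule finite_imageI)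
  qed
  ultimately have "{x. w (x + t, t) \<noteq> w (x, 0)} = {}"
    by (metis empty_interior_finite interior_open)
  then show ?thesis by blast
qed

text \<open>Here \<open>p\<close> and \<open>q\<close> stand for u_t and u_x, \<open>m\<close> and
  \<open>n\<close> for the two mixed derivatives, and \<open>r\<close> for the common value of u_tt
  and u_xx off the exceptional lines \<open>E\<close>. All derivatives are classical.\<close>

lemma dAlembert_formula:
  fixes u p q m n r :: "real \<times> real \<Rightarrow> real" and C :: "((real \<times> real) \<times> real) set"
  defines "H \<equiv> UNIV \<times> {0<..}"
  defines "E \<equiv> {z. \<exists>(c, b)\<in>C. c \<bullet> z = b}"
  assumes C: "finite C" "\<And>c b. (c, b) \<in> C \<Longrightarrow> c \<noteq> 0"
    and cu: "continuous_on (UNIV \<times> {0..}) u"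
    and cp: "continuous_on (UNIV \<times> {0..}) p" and cq: "continuous_on (UNIV \<times> {0..}) q"
    and p: "\<And>y s. (y, s) \<in> H \<Longrightarrow> ((\<lambda>z. u (y, z)) has_real_derivative p (y, s)) (at s)"
    and q: "\<And>y s. (y, s) \<in> H \<Longrightarrow> ((\<lambda>z. u (z, s)) has_real_derivative q (y, s)) (at y)"
    and m: "\<And>y s. (y, s) \<in> H \<Longrightarrow> ((\<lambda>z. p (z, s)) has_real_derivative m (y, s)) (at y)"
    and n: "\<And>y s. (y, s) \<in> H \<Longrightarrow> ((\<lambda>z. q (y, z)) has_real_derivative n (y, s)) (at s)"
    and cm: "continuous_on H m" and cn: "continuous_on H n"
    and pt: "\<And>y s. (y, s) \<in> H - E \<Longrightarrow> ((\<lambda>z. p (y, z)) has_real_derivative r (y, s)) (at s)"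
    and qx: "\<And>y s. (y, s) \<in> H - E \<Longrightarrow> ((\<lambda>z. q (z, s)) has_real_derivative r (y, s)) (at y)"
    and cr: "continuous_on (H - E) r"
    and q0: "\<And>y. ((\<lambda>z. u (z, 0)) has_real_derivative q (y, 0)) (at y)"
    and "t \<ge> 0"
  shows "u (x, t) = 1 / 2 * (u (x + t, 0) + u (x - t, 0)) + 1 / 2 * integral {x - t..x + t} (\<lambda>s. p (s, 0))"
proof -
  have H: "open H" unfolding H_def by (intro open_Times) auto
  have HE: "open (H - E)"
    unfolding E_def by (intro open_Diff H closed_finite_hyperplanes C(1))
  have mn: "m z = n z" if "z \<in> H" for z
    using mixed_partials_eq[OF H _ p q m n cm cn, of "fst z" "snd z"] that by simp
  define w where "w z = p z - q z" for z
  have cw: "continuous_on (UNIV \<times> {0..}) w" unfolding w_def by (intro continuous_intros cp cq)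
  have const: "w (y + s, s) = w (y, 0)" if "s \<ge> 0" for y s
  proof (rule constant_along_characteristics[OF C cw _ that])
    fix y s :: real assume "s > 0" and off: "\<And>c b. (c, b) \<in> C \<Longrightarrow> c \<bullet> (y + s, s) \<noteq> b"
    then have z: "(y + s, s) \<in> H - E" by (auto simp: H_def E_def)
    \<comment> \<open>In direction (1, 1) the two occurrences of \<open>r\<close> cancel and
      \<open>m - n\<close> remains, which is zero by symmetry of the mixed derivatives.\<close>
    have "((\<lambda>s. w (y + s, s)) has_real_derivative
        (m (y + s, s) - r (y + s, s)) * (0 + 1) + (r (y + s, s) - n (y + s, s)) * 1) (at s)"
    proof (rule DERIV_along_line[OF HE z, where wt = "\<lambda>z. r z - n z"])
      show "((\<lambda>z. w (z, s)) has_real_derivative m (y + s, s) - r (y + s, s)) (at (y + s))"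
        unfolding w_def using z by (intro derivative_intros m qx) auto
      show "((\<lambda>z. w (y', z)) has_real_derivative r (y', s') - n (y', s')) (at s')"
        if "(y', s') \<in> H - E" for y' s'
        unfolding w_def using that by (intro derivative_intros pt n) auto
      show "continuous_on (H - E) (\<lambda>z. r z - n z)"
        by (intro continuous_intros cr continuous_on_subset[OF cn]) auto
    qed (rule DERIV_add DERIV_const DERIV_ident refl)+
    then show "((\<lambda>s. w (y + s, s)) has_real_derivative 0) (at s)"
      using mn[of "(y + s, s)"] z by simp
  qed
  define \<Psi> where "\<Psi> y = integral {x - t..y} (\<lambda>s. p (s, 0))" for y
  have c0: "continuous_on A (\<lambda>s. p (s, 0))" for A
    by (auto intro!: continuous_on_compose2[OF cp] continuous_intros)
  have \<Psi>: "(\<Psi> has_real_derivative p (y, 0)) (at y)" if "x - t < y" "y < x + t" for y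
    using integral_has_real_derivative[OF c0, of y "x - t" "x + t"] that
    by (simp add: \<Psi>_def[abs_def] at_within_Icc_at)
  have cont\<Psi>: "continuous_on {x - t..x + t} \<Psi>"
    unfolding \<Psi>_def by (intro indefinite_integral_continuous_1 integrable_continuous_real c0)
  \<comment> \<open>The first term follows \<open>u\<close> along the other family of
    characteristics, from \<open>(x + t, 0)\<close> to \<open>(x, t)\<close>. Its derivative is
    \<open>w (x + t - s, s)\<close>, which equals \<open>w (y, 0)\<close> at the foot
    \<open>y = x + t - 2 * s\<close>. Since \<open>y\<close> moves with speed -2, the second term
    has derivative \<open>- w (y, 0)\<close>, so \<open>F\<close> is constant.\<close>
  define F where "F s = u (x + t - s, s) + (\<Psi> (x + t - 2 * s) - u (x + t - 2 * s, 0)) / 2" for s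
  have "((\<lambda>s. 0) has_integral F t - F 0) {0..t}"
  proof (rule fundamental_theorem_of_calculus_interior)
    show "continuous_on {0..t} F"
      unfolding F_def
      by (intro continuous_intros continuous_on_compose2[OF cont\<Psi>] continuous_on_compose2[OF cu]) auto
    fix s assume s: "s \<in> {0<..<t}"
    define y where "y = x + t - 2 * s"
    have zH: "(x + t - s, s) \<in> H" using s by (simp add: H_def)
    have du: "((\<lambda>s. u (x + t - s, s)) has_real_derivative
        q (x + t - s, s) * (0 - 1) + p (x + t - s, s) * 1) (at s)"
      using zH by (intro DERIV_along_line[OF H zH q p continuous_on_subset[OF cp]] derivative_intros)
        (auto simp: H_def)
    have dy: "((\<lambda>s. x + t - 2 * s) has_real_derivative - 2) (at s)"
      by (auto intro!: derivative_eq_intros)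
    have d1: "((\<lambda>s. \<Psi> (x + t - 2 * s)) has_real_derivative p (y, 0) * - 2) (at s)"
      using s by (intro DERIV_chain2[OF _ dy]) (auto simp: y_def intro!: \<Psi>)
    have d2: "((\<lambda>s. u (x + t - 2 * s, 0)) has_real_derivative q (y, 0) * - 2) (at s)"
      using s by (intro DERIV_chain2[where f = "\<lambda>z. u (z, 0)", OF _ dy]) (auto simp: y_def intro!: q0)
    have "(F has_real_derivative q (x + t - s, s) * (0 - 1) + p (x + t - s, s) * 1
        + (p (y, 0) * - 2 - q (y, 0) * - 2) / 2) (at s)"
      unfolding F_def by (intro DERIV_add DERIV_cdivide DERIV_diff du d1 d2)
    moreover have "w (x + t - s, s) = w (y, 0)"
      using const[of s y] s by (simp add: y_def algebra_simps)
    then have "q (x + t - s, s) * (0 - 1) + p (x + t - s, s) * 1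
        + (p (y, 0) * - 2 - q (y, 0) * - 2) / 2 = 0"
      by (simp add: w_def field_simps)
    ultimately show "(F has_vector_derivative 0) (at s)"
      by (simp only: has_real_derivative_iff_has_vector_derivative)
  qed (use \<open>t \<ge> 0\<close> in auto)
  then have "F t - F 0 = 0" by (rule has_integral_unique) simp
  \<comment> \<open>At \<open>s = t\<close> the foot is \<open>x - t\<close>, the base point of
    \<open>\<Psi>\<close>, so the integral vanishes; at \<open>s = 0\<close> the foot is
    \<open>x + t\<close> and the whole integral appears.\<close>
  moreover have "F t = u (x, t) - u (x - t, 0) / 2"
    by (simp add: F_def \<Psi>_def)
  moreover have "F 0 = u (x + t, 0) / 2 + integral {x - t..x + t} (\<lambda>s. p (s, 0)) / 2"
    by (simp add: F_def \<Psi>_def field_simps)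
  ultimately show ?thesis by (simp add: algebra_simps)
qed

section \<open>Specular derivatives on the half-plane\<close>

text \<open>Local boundedness of \<open>g\<close> makes \<open>v\<close> Lipschitz in the first
  variable, uniformly in the second, so separate continuity becomes joint. Only
  \<open>interior A\<close> carries a derivative hypothesis, which admits a half-line as
  \<open>A\<close>.\<close>

lemma continuous_on_Times_specular:
  fixes v g :: "real \<times> real \<Rightarrow> real"
  assumes AB: "convex A"
    and deriv: "\<And>y s. y \<in> interior A \<Longrightarrow> s \<in> B \<Longrightarrow> has_specular_derivative (\<lambda>z. v (z, s)) (g (y, s)) y"
    and cg: "continuous_on (A \<times> B) g"
    and c1: "\<And>s. s \<in> B \<Longrightarrow> continuous_on A (\<lambda>y. v (y, s))"
    and c2: "\<And>y. y \<in> A \<Longrightarrow> continuous_on B (\<lambda>s. v (y, s))"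
  shows "continuous_on (A \<times> B) v"
  unfolding continuous_on_def
proof
  fix z0 assume z0: "z0 \<in> A \<times> B"
  then obtain y0 s0 where z0_eq: "z0 = (y0, s0)" and y0: "y0 \<in> A" and s0: "s0 \<in> B" by auto
  obtain d where d: "d > 0" "\<And>z. z \<in> A \<times> B \<Longrightarrow> dist z z0 < d \<Longrightarrow> \<bar>g z - g z0\<bar> < 1"
    using cg z0 unfolding continuous_on_iff dist_real_def by (metis zero_less_one)
  have bound: "\<bar>v (y, s) - v (y0, s)\<bar> \<le> (\<bar>g z0\<bar> + 1) * \<bar>y - y0\<bar>"
    if y: "y \<in> A" and s: "s \<in> B" and near: "dist (y, s) z0 < d" for y s
  proof -
    have seg: "closed_segment y0 y \<subseteq> A" using AB y y0 by (simp add: convex_contains_segment)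
    have "open_segment y0 y \<subseteq> interior A"
      using seg segment_open_subset_closed[of y0 y]
      by (intro interior_maximal) (auto simp: open_segment_eq_real_ivl)
    then have der: "has_specular_derivative (\<lambda>z. v (z, s)) (g (z, s)) z" if "z \<in> open_segment y0 y" for z
      using deriv[OF _ s] that by blast
    \<comment> \<open>Points of the segment towards \<open>y0\<close> are no farther from
      \<open>z0\<close> than \<open>(y, s)\<close>, so they stay where \<open>g\<close> is within 1
      of \<open>g z0\<close>.\<close>
    have gb: "\<bar>g (z, s) - g z0\<bar> \<le> 1" if z: "z \<in> open_segment y0 y" for z
    proof -
      have "z \<in> closed_segment y0 y" using z by (simp add: open_segment_def)
      then have "dist z y0 \<le> dist y y0"
        by (auto simp: closed_segment_eq_real_ivl dist_real_def split: if_splits)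
      then have "dist (z, s) z0 \<le> dist (y, s) z0"
        by (auto simp: z0_eq dist_Pair_Pair intro!: real_sqrt_le_mono power_mono)
      then show ?thesis
        using d(2)[of "(z, s)"] near seg s \<open>z \<in> closed_segment y0 y\<close> by fastforce
    qed
    have "\<bar>v (y, s) - v (y0, s) - g z0 * (y - y0)\<bar> \<le> 1 * \<bar>y - y0\<bar>"
      by (rule specular_mean_value_abs[OF continuous_on_subset[OF c1[OF s] seg] der gb])
    moreover have "\<bar>g z0 * (y - y0)\<bar> = \<bar>g z0\<bar> * \<bar>y - y0\<bar>" by (rule abs_mult)
    ultimately show ?thesis unfolding distrib_right by linarith
  qed
  \<comment> \<open>The value \<open>v z\<close> is compared with that at the projection onto the
    fibre over \<open>y0\<close>, along which \<open>v\<close> is continuous.\<close>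
  have "((\<lambda>z. v z - v (y0, snd z)) \<longlongrightarrow> 0) (at z0 within A \<times> B)"
  proof (rule Lim_null_comparison)
    show "\<forall>\<^sub>F z in at z0 within A \<times> B. norm (v z - v (y0, snd z)) \<le> (\<bar>g z0\<bar> + 1) * \<bar>fst z - y0\<bar>"
      unfolding eventually_at using d bound by auto
    have "((\<lambda>z. (\<bar>g z0\<bar> + 1) * \<bar>fst z - y0\<bar>) \<longlongrightarrow> (\<bar>g z0\<bar> + 1) * \<bar>fst z0 - y0\<bar>) (at z0 within A \<times> B)"
      by (intro tendsto_intros)
    then show "((\<lambda>z. (\<bar>g z0\<bar> + 1) * \<bar>fst z - y0\<bar>) \<longlongrightarrow> 0) (at z0 within A \<times> B)"
      by (simp add: z0_eq)
  qed
  moreover have "continuous_on (A \<times> B) (\<lambda>z. v (y0, snd z))"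
    by (rule continuous_on_compose2[OF c2[OF y0]]) (auto intro: continuous_intros)
  then have "((\<lambda>z. v (y0, snd z)) \<longlongrightarrow> v (y0, snd z0)) (at z0 within A \<times> B)"
    using z0 unfolding continuous_on_def by (rule bspec)
  ultimately have "((\<lambda>z. v z - v (y0, snd z) + v (y0, snd z)) \<longlongrightarrow> 0 + v (y0, snd z0)) (at z0 within A \<times> B)"
    by (rule tendsto_add)
  then show "(v \<longlongrightarrow> v z0) (at z0 within A \<times> B)" by (simp add: z0_eq)
qed

section \<open>One-sided limits and specular partial derivatives on a general domain\<close>

lemma right_side_neq_bot [simp]: "right_side X e a \<noteq> bot"
  by (simp add: right_side_def)

lemma left_side_neq_bot [simp]: "left_side X e a \<noteq> bot"
  by (simp add: left_side_def)

lemma right_limit_eq: "has_right_limit X e v a l \<Longrightarrow> right_limit X e v a = l"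
  unfolding right_limit_def has_right_limit_def
  by (rule the_equality) (auto intro: tendsto_unique[rotated])

lemma left_limit_eq: "has_left_limit X e v a l \<Longrightarrow> left_limit X e v a = l"
  unfolding left_limit_def has_left_limit_def
  by (rule the_equality) (auto intro: tendsto_unique[rotated])

lemma right_derivative_eq: "has_right_derivative X e v a d \<Longrightarrow> right_derivative X e v a = d"
  unfolding right_derivative_def has_right_derivative_def
  by (rule the_equality) (auto intro: tendsto_unique[rotated])

lemma left_derivative_eq: "has_left_derivative X e v a d \<Longrightarrow> left_derivative X e v a = d"
  unfolding left_derivative_def has_left_derivative_def
  by (rule the_equality) (auto intro: tendsto_unique[rotated])

text \<open>The specular mean of two equal numbers is that number, so the value prescribed by
  \<open>S0\<close> is the common one-sided limit.\<close>

lemma S0_limits: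
  assumes "v \<in> S0 X" "a \<in> X" "e \<in> Basis" "right_limit X e v a = left_limit X e v a"
  shows "has_right_limit X e v a (v a)" "has_left_limit X e v a (v a)"
proof -
  have "one_sided_limits_exist X e v a"
    and va: "v a = specular_mean (left_limit X e v a) (right_limit X e v a)"
    using assms(1-3) by (auto simp: S0_def)
  then obtain l r where lr: "has_right_limit X e v a r" "has_left_limit X e v a l"
    unfolding one_sided_limits_exist_def by blast
  then have "l = r" "v a = r" using assms(4) va right_limit_eq[OF lr(1)] left_limit_eq[OF lr(2)] by auto
  then show "has_right_limit X e v a (v a)" "has_left_limit X e v a (v a)" using lr by auto
qed

text \<open>Bridge to the one-variable notion: \<open>S0_limits\<close> replaces the one-sided
  limits in the quotients by \<open>v a\<close>. The assumption \<open>sides\<close> restricts it to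
  points with genuine neighbours on both sides along \<open>e\<close>.\<close>

lemma has_specular_derivative_specular_partial:
  assumes "v \<in> S0 X" "a \<in> X" "e \<in> Basis" "specularly_partial_differentiable X e v a"
    and sides: "right_side X e a = at_right 0" "left_side X e a = at_left 0"
  shows "has_specular_derivative (\<lambda>h. v (a + h *\<^sub>R e)) (specular_partial X e v a) 0"
proof -
  obtain \<alpha> \<beta> where d: "has_right_derivative X e v a \<alpha>" "has_left_derivative X e v a \<beta>"
    and eq: "right_limit X e v a = left_limit X e v a"
    using assms(4) by (auto simp: specularly_partial_differentiable_def)
  have lim: "right_limit X e v a = v a" "left_limit X e v a = v a"
    using S0_limits[OF assms(1-3) eq] right_limit_eq left_limit_eq by blast+
  have "specular_partial X e v a = specular_mean \<alpha> \<beta>"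
    using d by (simp add: specular_partial_def right_derivative_eq left_derivative_eq)
  then show ?thesis
    unfolding has_specular_derivative_def
    using d by (intro exI[of _ \<alpha>] exI[of _ \<beta>])
      (simp add: has_right_derivative_def has_left_derivative_def lim sides)
qed

text \<open>Both one-sided derivatives are \<open>d\<close>, and so is their specular mean. The
  sides need only refine the filter of \<open>has_partial\<close>, which includes boundary points,
  where the two sides coincide.\<close>

lemma specular_partial_has_partial:
  assumes d: "has_partial X e v a d"
    and sides: "right_side X e a \<le> at 0 within {h. a + h *\<^sub>R e \<in> X}"
      "left_side X e a \<le> at 0 within {h. a + h *\<^sub>R e \<in> X}"
  shows "specular_partial X e v a = d"
proof -
  define F where "F = at 0 within {h. a + h *\<^sub>R e \<in> X}"
  have q: "((\<lambda>h. (v (a + h *\<^sub>R e) - v a) / h) \<longlongrightarrow> d) F"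
    using d by (simp add: has_partial_def has_field_derivative_iff F_def)
  have "((\<lambda>h. v (a + h *\<^sub>R e)) \<longlongrightarrow> v (a + 0 *\<^sub>R e)) F"
    unfolding F_def using has_field_derivative_imp_has_derivative[THEN has_derivative_continuous]
      d[unfolded has_partial_def] continuous_within by blast
  then have c: "((\<lambda>h. v (a + h *\<^sub>R e)) \<longlongrightarrow> v a) F" by simp
  have "has_right_limit X e v a (v a)" "has_left_limit X e v a (v a)"
    unfolding has_right_limit_def has_left_limit_def
    using c sides unfolding F_def by (auto intro: tendsto_mono)
  moreover from this have "has_right_derivative X e v a d" "has_left_derivative X e v a d"
    unfolding has_right_derivative_def has_left_derivative_def
    using q sides unfolding F_def by (auto intro: tendsto_mono simp: right_limit_eq left_limit_eq)
  ultimately show ?thesis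
    by (simp add: specular_partial_def right_derivative_eq left_derivative_eq)
qed

text \<open>Limits and quotients never use the value at \<open>a\<close> itself, so agreement near
  \<open>a\<close> along \<open>e\<close> suffices.\<close>

lemma specular_partial_cong:
  assumes "\<forall>\<^sub>F h in right_side X e a. v (a + h *\<^sub>R e) = v' (a + h *\<^sub>R e)"
    and "\<forall>\<^sub>F h in left_side X e a. v (a + h *\<^sub>R e) = v' (a + h *\<^sub>R e)"
  shows "specular_partial X e v a = specular_partial X e v' a"
proof -
  have r: "has_right_limit X e v a = has_right_limit X e v' a"
    and l: "has_left_limit X e v a = has_left_limit X e v' a"
    using assms by (auto simp: fun_eq_iff has_right_limit_def has_left_limit_def intro!: tendsto_cong)
  then have lim: "right_limit X e v a = right_limit X e v' a" "left_limit X e v a = left_limit X e v' a"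
    by (simp_all add: right_limit_def left_limit_def)
  have "has_right_derivative X e v a = has_right_derivative X e v' a"
    unfolding has_right_derivative_def fun_eq_iff r lim
    using assms(1) by (auto intro!: conj_cong tendsto_cong elim: eventually_mono)
  moreover have "has_left_derivative X e v a = has_left_derivative X e v' a"
    unfolding has_left_derivative_def fun_eq_iff l lim
    using assms(2) by (auto intro!: conj_cong tendsto_cong elim: eventually_mono)
  ultimately show ?thesis
    by (simp add: specular_partial_def right_derivative_def left_derivative_def)
qed

section \<open>The closed half-plane: sides, classical derivatives and joint continuity\<close>

lemma e_x_Basis: "e\<^sub>x \<in> Basis" and e_t_Basis: "e\<^sub>t \<in> Basis"
  by (auto simp: e\<^sub>x_def e\<^sub>t_def Basis_prod_def)

lemma add_e_x [simp]: "(x, t) + h *\<^sub>R e\<^sub>x = (x + h, t)"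
  and add_e_t [simp]: "(x, t) + h *\<^sub>R e\<^sub>t = (x, t + h)"
  by (simp_all add: e\<^sub>x_def e\<^sub>t_def)

lemma mem_closed_half_plane [simp]: "(x, t) \<in> closed_half_plane \<longleftrightarrow> 0 \<le> t"
  by (simp add: closed_half_plane_def)

lemma sides_e_x:
  assumes "0 \<le> t"
  shows "right_side closed_half_plane e\<^sub>x (x, t) = at_right 0"
    and "left_side closed_half_plane e\<^sub>x (x, t) = at_left 0"
  using assms by (simp_all add: right_side_def left_side_def)

lemma eventually_add_pos:
  assumes "(0::real) < t"
  shows "\<forall>\<^sub>F h in at 0 within A. 0 < t + h"
proof -
  have "((\<lambda>h. t + h) \<longlongrightarrow> t + 0) (at 0 within A)" by (intro tendsto_intros)
  then show ?thesis using assms by (intro order_tendstoD(1)) auto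
qed

lemma sides_e_t:
  assumes "0 < t"
  shows "right_side closed_half_plane e\<^sub>t (x, t) = at_right 0"
    and "left_side closed_half_plane e\<^sub>t (x, t) = at_left 0"
proof -
  have "\<forall>\<^sub>F h in at 0 within A. 0 \<le> t + h" for A
    by (rule eventually_mono[OF eventually_add_pos[OF assms]]) simp
  then show "right_side closed_half_plane e\<^sub>t (x, t) = at_right 0"
    and "left_side closed_half_plane e\<^sub>t (x, t) = at_left 0"
    by (simp_all add: right_side_def left_side_def)
qed

lemma sides_e_t_0:
  shows "right_side closed_half_plane e\<^sub>t (x, 0) = at_right 0"
    and "left_side closed_half_plane e\<^sub>t (x, 0) = at_right 0"
proof -
  have "\<forall>\<^sub>F h in at_right 0. (0::real) \<le> h"
    by (auto simp: eventually_at_filter)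
  then show "right_side closed_half_plane e\<^sub>t (x, 0) = at_right 0"
    by (simp add: right_side_def)
  have "\<not> (\<forall>\<^sub>F h in at_left 0. (0::real) \<le> h)"
  proof
    assume "\<forall>\<^sub>F h in at_left 0. (0::real) \<le> h"
    moreover have "\<forall>\<^sub>F h in at_left 0. h < (0::real)" by (auto simp: eventually_at_filter)
    ultimately have "\<forall>\<^sub>F h in at_left (0::real). False" by eventually_elim simp
    then show False by simp
  qed
  then show "left_side closed_half_plane e\<^sub>t (x, 0) = at_right 0"
    by (simp add: left_side_def)
qed

lemma specular_partial_e_x_has_partial:
  assumes "0 \<le> t" "has_partial closed_half_plane e\<^sub>x v (x, t) d"
  shows "specular_partial closed_half_plane e\<^sub>x v (x, t) = d"
  using assms by (intro specular_partial_has_partial)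
    (simp_all add: sides_e_x at_le)

lemma specular_partial_e_t_has_partial:
  assumes "0 \<le> t" "has_partial closed_half_plane e\<^sub>t v (x, t) d"
  shows "specular_partial closed_half_plane e\<^sub>t v (x, t) = d"
proof -
  define S where "S = {h. 0 \<le> t + h}"
  have "right_side closed_half_plane e\<^sub>t (x, t) \<le> at 0 within S \<and>
      left_side closed_half_plane e\<^sub>t (x, t) \<le> at 0 within S"
  proof (cases "t = 0")
    case True
    then show ?thesis by (auto simp: sides_e_t_0 S_def intro!: at_le)
  next
    case False
    then have "t > 0" using assms(1) by simp
    have "at 0 within S = at 0"
      by (rule at_within_nhd[of _ "{- t<..}"]) (use \<open>t > 0\<close> in \<open>auto simp: S_def\<close>)
    then show ?thesis using \<open>t > 0\<close> by (simp add: sides_e_t at_le)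
  qed
  then show ?thesis
    using assms(2) by (intro specular_partial_has_partial) (simp_all add: S_def)
qed

text \<open>Uniqueness comes from the specular side: every candidate equals the single value of
  \<open>specular_partial\<close>.\<close>

lemma has_partial_unique_half_plane:
  assumes "0 \<le> t"
  shows "has_partial closed_half_plane e\<^sub>x v (x, t) d \<Longrightarrow> u_x v (x, t) = d"
    and "has_partial closed_half_plane e\<^sub>t v (x, t) d \<Longrightarrow> u_t v (x, t) = d"
  using assms specular_partial_e_x_has_partial specular_partial_e_t_has_partial
  unfolding partial_def by (metis the_equality)+

lemma has_specular_derivative_e_x:
  assumes "v \<in> S0 closed_half_plane" "0 \<le> t"
    and "specularly_partial_differentiable closed_half_plane e\<^sub>x v (x, t)"
  shows "has_specular_derivative (\<lambda>z. v (z, t)) (specular_partial closed_half_plane e\<^sub>x v (x, t)) x"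
  using has_specular_derivative_specular_partial[OF assms(1) _ e_x_Basis assms(3)] assms(2)
  by (simp add: sides_e_x has_specular_derivative_def)

lemma has_specular_derivative_e_t:
  assumes "v \<in> S0 closed_half_plane" "0 < t"
    and "specularly_partial_differentiable closed_half_plane e\<^sub>t v (x, t)"
  shows "has_specular_derivative (\<lambda>z. v (x, z)) (specular_partial closed_half_plane e\<^sub>t v (x, t)) t"
  using has_specular_derivative_specular_partial[OF assms(1) _ e_t_Basis assms(3)] assms(2)
  by (simp add: sides_e_t has_specular_derivative_def)

lemma continuous_on_e_x:
  assumes "v \<in> S0 closed_half_plane" "0 \<le> t"
    and "\<And>x. specularly_partial_differentiable closed_half_plane e\<^sub>x v (x, t)"
  shows "continuous_on UNIV (\<lambda>z. v (z, t))"
  using has_specular_derivative_e_x[OF assms] has_specular_derivative_isCont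
  by (metis continuous_at_imp_continuous_on)

lemma continuous_on_e_t:
  assumes v: "v \<in> S0 closed_half_plane"
    and d: "\<And>t. 0 \<le> t \<Longrightarrow> specularly_partial_differentiable closed_half_plane e\<^sub>t v (x, t)"
  shows "continuous_on {0..} (\<lambda>z. v (x, z))"
  unfolding continuous_on_eq_continuous_within
proof
  fix t :: real assume t: "t \<in> {0..}"
  show "continuous (at t within {0..}) (\<lambda>z. v (x, z))"
  proof (cases "t = 0")
    case True
    \<comment> \<open>At t = 0 no two-sided derivative is available; continuity from above is read
      off from the one-sided limit, which \<open>S0\<close> identifies with the value.\<close>
    have "has_right_limit closed_half_plane e\<^sub>t v (x, 0) (v (x, 0))"
      using d[of 0] by (intro S0_limits v e_t_Basis) (auto simp: specularly_partial_differentiable_def)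
    then have "((\<lambda>h. v (x, h)) \<longlongrightarrow> v (x, 0)) (at_right 0)"
      by (simp add: has_right_limit_def sides_e_t_0)
    moreover have "at (0::real) within {0..} = at_right 0"
      by (simp add: at_within_def filter_eq_iff eventually_inf_principal)
         (auto simp: eventually_nhds_metric)
    ultimately show ?thesis
      using True by (simp add: continuous_within)
  next
    case False
    then show ?thesis
      using has_specular_derivative_isCont[OF has_specular_derivative_e_t[OF v _ d]] t
      by (simp add: continuous_at_imp_continuous_at_within)
  qed
qed

text \<open>Meant for u_t, whose specular x-derivative is one of the continuous mixed
  derivatives.\<close>

lemma continuous_on_half_plane_x:
  assumes v: "v \<in> S0 closed_half_plane"
    and dx: "\<And>a. a \<in> closed_half_plane \<Longrightarrow> specularly_partial_differentiable closed_half_plane e\<^sub>x v a"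
    and dt: "\<And>a. a \<in> closed_half_plane \<Longrightarrow> specularly_partial_differentiable closed_half_plane e\<^sub>t v a"
    and c: "continuous_on closed_half_plane (specular_partial closed_half_plane e\<^sub>x v)"
  shows "continuous_on closed_half_plane v"
  unfolding closed_half_plane_def
  by (rule continuous_on_Times_specular[where g = "specular_partial closed_half_plane e\<^sub>x v"])
    (use c in \<open>auto intro!: has_specular_derivative_e_x continuous_on_e_x continuous_on_e_t v dx dt
       simp flip: closed_half_plane_def\<close>)

text \<open>Meant for u_x. The coordinates are exchanged by \<open>prod.swap\<close>, and the
  differentiated variable then runs through \<open>{0..}\<close>, whose interior avoids the
  one-sided derivative at t = 0.\<close>

lemma continuous_on_half_plane_t:
  assumes v: "v \<in> S0 closed_half_plane"
    and dx: "\<And>a. a \<in> closed_half_plane \<Longrightarrow> specularly_partial_differentiable closed_half_plane e\<^sub>x v a"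
    and dt: "\<And>a. a \<in> closed_half_plane \<Longrightarrow> specularly_partial_differentiable closed_half_plane e\<^sub>t v a"
    and c: "continuous_on closed_half_plane (specular_partial closed_half_plane e\<^sub>t v)"
  shows "continuous_on closed_half_plane v"
proof -
  have swap: "continuous_on A prod.swap" for A :: "(real \<times> real) set"
    by (simp add: prod.swap_def continuous_on_Pair continuous_on_fst continuous_on_snd)
  have "continuous_on ({0..} \<times> UNIV) (\<lambda>z. v (prod.swap z))"
    by (rule continuous_on_Times_specular[where
          g = "\<lambda>z. specular_partial closed_half_plane e\<^sub>t v (prod.swap z)"])
      (use c in \<open>auto intro!: has_specular_derivative_e_t continuous_on_e_x continuous_on_e_t v dx dt
         continuous_on_compose2[OF c swap]\<close>)
  then have "continuous_on closed_half_plane (\<lambda>z. v (prod.swap (prod.swap z)))"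
    by (rule continuous_on_compose2[OF _ swap]) (auto simp: closed_half_plane_def)
  then show ?thesis by simp
qed

text \<open>Each singular graph is only the part of a hyperplane over some connected set. Passing to
  the full hyperplanes keeps continuity and makes the exceptional set closed and met by transversal
  lines in finitely many points.\<close>

lemma piecewise_continuous_off_hyperplanes:
  assumes "piecewise_continuous X v"
  obtains C where "finite C" "0 \<notin> fst ` C"
    "continuous_on (X - {z. \<exists>(c, b)\<in>C. c \<bullet> z = b}) v"
proof -
  obtain \<H> where \<H>: "finite \<H>" "\<And>G. G \<in> \<H> \<Longrightarrow> singular_hyperplane_graph X v G"
    and cont: "continuous_on (X - \<Union>\<H>) v"
    using assms unfolding piecewise_continuous_def by blast
  have "\<forall>G\<in>\<H>. \<exists>cb. fst cb \<noteq> 0 \<and> (\<forall>z\<in>G. fst cb \<bullet> z = snd cb)"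
  proof
    fix G assume "G \<in> \<H>"
    then obtain Y c b where "c \<noteq> 0" "G = {z \<in> Y. c \<bullet> z = b}"
      using \<H>(2) unfolding singular_hyperplane_graph_def affine_hyperplane_graph_def by blast
    then show "\<exists>cb. fst cb \<noteq> 0 \<and> (\<forall>z\<in>G. fst cb \<bullet> z = snd cb)"
      by (intro exI[of _ "(c, b)"]) simp
  qed
  then obtain f where f: "\<And>G. G \<in> \<H> \<Longrightarrow> fst (f G) \<noteq> 0"
      "\<And>G z. G \<in> \<H> \<Longrightarrow> z \<in> G \<Longrightarrow> fst (f G) \<bullet> z = snd (f G)"
    by (metis bchoice)
  show thesis
  proof (rule that[of "f ` \<H>"])
    show "finite (f ` \<H>)" using \<H>(1) by simp
    show "0 \<notin> fst ` f ` \<H>" using f(1) by (metis imageE)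
    have "X - {z. \<exists>(c, b)\<in>f ` \<H>. c \<bullet> z = b} \<subseteq> X - \<Union>\<H>"
      using f(2) by (auto simp: case_prod_unfold)
    then show "continuous_on (X - {z. \<exists>(c, b)\<in>f ` \<H>. c \<bullet> z = b}) v"
      using cont continuous_on_subset by blast
  qed
qed

section \<open>Unfolding membership in S^2 and the initial value problem\<close>

lemma S_half_plane_2:
  fixes u :: "real \<times> real \<Rightarrow> real"
  defines "X \<equiv> closed_half_plane"
  defines "p \<equiv> specular_partial X e\<^sub>t u" and "q \<equiv> specular_partial X e\<^sub>x u"
  assumes u: "u \<in> S_half_plane 2"
  shows "continuous_on X u"
    and "u \<in> S0 X" "p \<in> S0 X" "q \<in> S0 X" "specular_partial X e\<^sub>t p \<in> S0 X"
    and "\<And>a. a \<in> X \<Longrightarrow> specularly_partial_differentiable X e\<^sub>x u a"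
    and "\<And>a. a \<in> X \<Longrightarrow> specularly_partial_differentiable X e\<^sub>t u a"
    and "\<And>a. a \<in> X \<Longrightarrow> specularly_partial_differentiable X e\<^sub>x p a"
    and "\<And>a. a \<in> X \<Longrightarrow> specularly_partial_differentiable X e\<^sub>t p a"
    and "\<And>a. a \<in> X \<Longrightarrow> specularly_partial_differentiable X e\<^sub>x q a"
    and "\<And>a. a \<in> X \<Longrightarrow> specularly_partial_differentiable X e\<^sub>t q a"
    and "continuous_on X (specular_partial X e\<^sub>x p)"
    and "continuous_on X (specular_partial X e\<^sub>t q)"
proof -
  have multi: "specular_multi_exists X [e\<^sub>x, e\<^sub>t] [i, j] u \<and> specular_multi X [e\<^sub>x, e\<^sub>t] [i, j] u \<in> S0 X"
    if "i + j \<le> 2" for i j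
  proof -
    have "\<forall>\<alpha>. length \<alpha> = length [e\<^sub>x, e\<^sub>t] \<longrightarrow> sum_list \<alpha> \<le> 2 \<longrightarrow>
        specular_multi_exists X [e\<^sub>x, e\<^sub>t] \<alpha> u \<and> specular_multi X [e\<^sub>x, e\<^sub>t] \<alpha> u \<in> S0 X"
      using u unfolding S_half_plane_def S_space_def X_def by blast
    from this[rule_format, of "[i, j]"] that show ?thesis by simp
  qed
  have mixed: "(\<forall>a\<in>X. specularly_partial_differentiable X j (specular_partial X i u) a) \<and>
      continuous_on X (specular_partial X j (specular_partial X i u))"
    if "i \<in> {e\<^sub>x, e\<^sub>t}" "j \<in> {e\<^sub>x, e\<^sub>t}" "i \<noteq> j" for i j
  proof -
    have "\<forall>\<alpha>. length \<alpha> = length [e\<^sub>x, e\<^sub>t] \<longrightarrow> sum_list \<alpha> + 2 \<le> 2 \<longrightarrow>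
        (\<forall>i\<in>set [e\<^sub>x, e\<^sub>t]. \<forall>j\<in>set [e\<^sub>x, e\<^sub>t]. i \<noteq> j \<longrightarrow>
           (let w = specular_multi X [e\<^sub>x, e\<^sub>t] \<alpha> u in
             (\<forall>a\<in>X. specularly_partial_differentiable X i w a) \<and>
             (\<forall>a\<in>X. specularly_partial_differentiable X j (specular_partial X i w) a) \<and>
             continuous_on X (specular_partial X j (specular_partial X i w))))"
      using u unfolding S_half_plane_def S_space_def X_def by blast
    \<comment> \<open>For order 2 the zero multi-index is the only one that meets the bound, so the
      mixed derivatives are those of \<open>u\<close> itself.\<close>
    from this[rule_format, of "[0, 0]" i j] that show ?thesis by (simp add: Let_def)
  qed
  have ne: "e\<^sub>x \<noteq> e\<^sub>t" by (simp add: e\<^sub>x_def e\<^sub>t_def)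
  show "continuous_on X u" using u by (simp add: S_half_plane_def S_space_def X_def)
  show "u \<in> S0 X" using multi[of 0 0] by simp
  show "p \<in> S0 X" using multi[of 0 1] by (simp add: p_def)
  show "q \<in> S0 X" using multi[of 1 0] by (simp add: q_def)
  show "specular_partial X e\<^sub>t p \<in> S0 X"
    using multi[of 0 2] by (simp add: p_def numeral_2_eq_2)
  show "continuous_on X (specular_partial X e\<^sub>x p)" "continuous_on X (specular_partial X e\<^sub>t q)"
    using mixed[of "e\<^sub>t" "e\<^sub>x"] mixed[of "e\<^sub>x" "e\<^sub>t"] ne by (auto simp: p_def q_def)
  fix a assume a: "a \<in> X"
  show "specularly_partial_differentiable X e\<^sub>x u a" using multi[of 1 0] a by simp
  show "specularly_partial_differentiable X e\<^sub>t u a" using multi[of 0 1] a by simp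
  \<comment> \<open>In the multi-index \<open>[0, 2]\<close> the case \<open>j = 0\<close> of the
    existence condition concerns \<open>u\<close> and the case \<open>j = 1\<close> concerns
    \<open>p\<close>.\<close>
  show "specularly_partial_differentiable X e\<^sub>t p a"
    using multi[of 0 2] a by (simp add: p_def numeral_2_eq_2 less_Suc_eq_0_disj all_conj_distrib)
  show "specularly_partial_differentiable X e\<^sub>x q a"
    using multi[of 2 0] a by (simp add: q_def numeral_2_eq_2 less_Suc_eq_0_disj all_conj_distrib)
  show "specularly_partial_differentiable X e\<^sub>x p a" "specularly_partial_differentiable X e\<^sub>t q a"
    using mixed[of "e\<^sub>t" "e\<^sub>x"] mixed[of "e\<^sub>x" "e\<^sub>t"] ne a by (auto simp: p_def q_def)
qed

text \<open>The one-variable criterion on a horizontal slice. Intersecting \<open>S\<close> with the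
  half-plane admits t = 0, where the x-direction is still two-sided; the counterpart in t needs
  \<open>S\<close> inside the open half-plane.\<close>

lemma DERIV_e_x:
  assumes v: "v \<in> S0 closed_half_plane" and t: "0 \<le> t"
    and d: "\<And>y. specularly_partial_differentiable closed_half_plane e\<^sub>x v (y, t)"
    and S: "open S" "(x, t) \<in> S"
    and c: "continuous_on (S \<inter> closed_half_plane) (specular_partial closed_half_plane e\<^sub>x v)"
  shows "((\<lambda>z. v (z, t)) has_real_derivative specular_partial closed_half_plane e\<^sub>x v (x, t)) (at x)"
proof (rule has_specular_derivative_imp_DERIV[where S = "(\<lambda>z. (z, t)) -` S"])
  have cont: "continuous_on UNIV (\<lambda>z. (z, t))" by (intro continuous_intros)
  show op: "open ((\<lambda>z. (z, t)) -` S)" by (rule open_vimage[OF S(1) cont])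
  show "has_specular_derivative (\<lambda>z. v (z, t)) (specular_partial closed_half_plane e\<^sub>x v (y, t)) y" for y
    by (rule has_specular_derivative_e_x[OF v t d])
  have "continuous_on ((\<lambda>z. (z, t)) -` S) (\<lambda>z. specular_partial closed_half_plane e\<^sub>x v (z, t))"
    by (rule continuous_on_compose2[OF c continuous_on_subset[OF cont]]) (use t in auto)
  then show "isCont (\<lambda>z. specular_partial closed_half_plane e\<^sub>x v (z, t)) x"
    using op S(2) by (simp add: continuous_on_eq_continuous_at)
qed (use S in simp)

lemma DERIV_e_t:
  assumes v: "v \<in> S0 closed_half_plane"
    and d: "\<And>s. 0 < s \<Longrightarrow> specularly_partial_differentiable closed_half_plane e\<^sub>t v (x, s)"
    and S: "open S" "(x, t) \<in> S" "S \<subseteq> UNIV \<times> {0<..}"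
    and c: "continuous_on S (specular_partial closed_half_plane e\<^sub>t v)"
  shows "((\<lambda>z. v (x, z)) has_real_derivative specular_partial closed_half_plane e\<^sub>t v (x, t)) (at t)"
proof (rule has_specular_derivative_imp_DERIV[where S = "(\<lambda>z. (x, z)) -` S"])
  have cont: "continuous_on UNIV (\<lambda>z. (x, z))" by (intro continuous_intros)
  show op: "open ((\<lambda>z. (x, z)) -` S)" by (rule open_vimage[OF S(1) cont])
  show "has_specular_derivative (\<lambda>z. v (x, z)) (specular_partial closed_half_plane e\<^sub>t v (x, s)) s"
    if "s \<in> (\<lambda>z. (x, z)) -` S" for s
  proof -
    have s: "0 < s" using that S(3) by auto
    show ?thesis by (rule has_specular_derivative_e_t[OF v s d[OF s]])
  qed
  have "continuous_on ((\<lambda>z. (x, z)) -` S) (\<lambda>z. specular_partial closed_half_plane e\<^sub>t v (x, z))"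
    by (rule continuous_on_compose2[OF c continuous_on_subset[OF cont]]) auto
  then show "isCont (\<lambda>z. specular_partial closed_half_plane e\<^sub>t v (x, z)) t"
    using op S(2) by (simp add: continuous_on_eq_continuous_at)
qed (use S in simp)

text \<open>The problem is posed with classical first derivatives, the space S^2 with specular ones;
  where the classical ones exist, the two coincide.\<close>

lemma S_half_plane_2_solution:
  fixes u :: "real \<times> real \<Rightarrow> real"
  defines "X \<equiv> closed_half_plane"
  defines "p \<equiv> specular_partial X e\<^sub>t u" and "q \<equiv> specular_partial X e\<^sub>x u"
  assumes u: "u \<in> S_half_plane 2" and sol: "solves_wave_ivp \<phi> \<psi> u"
  shows "\<And>y. p (y, 0) = \<psi> y"
    and "\<And>z. z \<in> UNIV \<times> {0<..} \<Longrightarrow> specular_partial X e\<^sub>t p z = specular_partial X e\<^sub>x q z"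
proof -
  have ut: "u_t u (y, s) = p (y, s)" and ux: "u_x u (y, s) = q (y, s)" if "0 < s" for y s
  proof -
    obtain d d' where "has_partial X e\<^sub>t u (y, s) d" "has_partial X e\<^sub>x u (y, s) d'"
      using sol \<open>0 < s\<close> unfolding solves_wave_ivp_def X_def by force
    then show "u_t u (y, s) = p (y, s)" "u_x u (y, s) = q (y, s)"
      using \<open>0 < s\<close> has_partial_unique_half_plane[of s u y]
        specular_partial_e_t_has_partial[of s u y] specular_partial_e_x_has_partial[of s u y]
      by (auto simp: p_def q_def X_def)
  qed
  show "p (y, 0) = \<psi> y" for y
    using sol specular_partial_e_t_has_partial[of 0 u y "\<psi> y"]
    by (simp add: solves_wave_ivp_def p_def X_def)
  fix z :: "real \<times> real" assume "z \<in> UNIV \<times> {0<..}"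
  then obtain y s where z: "z = (y, s)" "0 < s" by auto
  \<comment> \<open>The identity \<open>ut\<close> is available for positive times, so in the
    t-direction it holds only for small increments.\<close>
  have "\<forall>\<^sub>F h in at 0 within A. u_t u (y, s + h) = p (y, s + h)" for A
    by (rule eventually_mono[OF eventually_add_pos[OF z(2)]]) (rule ut)
  then have "specular_partial X e\<^sub>t (u_t u) (y, s) = specular_partial X e\<^sub>t p (y, s)"
    using z(2) unfolding X_def by (intro specular_partial_cong) (simp_all add: sides_e_t)
  moreover have "specular_partial X e\<^sub>x (u_x u) (y, s) = specular_partial X e\<^sub>x q (y, s)"
    using ux z(2) unfolding X_def by (intro specular_partial_cong) auto
  moreover have "specular_partial X e\<^sub>t (u_t u) (y, s) = specular_partial X e\<^sub>x (u_x u) (y, s)"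
    using sol z unfolding solves_wave_ivp_def X_def by force
  ultimately show "specular_partial X e\<^sub>t p z = specular_partial X e\<^sub>x q z" by (simp add: z)
qed

section \<open>D'Alembert's formula for S^2-solutions\<close>

theorem theorem4p3:
  fixes \<phi> \<psi> :: "real \<Rightarrow> real" and u :: "real \<times> real \<Rightarrow> real"
  assumes "\<phi> \<in> S_line 2" and "\<psi> \<in> S_line 1"
    and "u \<in> S_half_plane 2"
    and "solves_wave_ivp \<phi> \<psi> u"
    and "\<forall>p \<in> UNIV \<times> {0<..}. \<exists>T. strong_specular_tangent_hyperplane closed_half_plane
           (\<lambda>q. u_t u q - u_x u q) p T"
  shows "\<forall>x. \<forall>t\<ge>0. u (x, t) =
           1 / 2 * (\<phi> (x + t) + \<phi> (x - t)) + 1 / 2 * integral {x - t..x + t} \<psi>"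
proof (intro allI impI)
  fix x t :: real assume t: "0 \<le> t"
  let ?X = closed_half_plane
  define p q where "p = specular_partial ?X e\<^sub>t u" and "q = specular_partial ?X e\<^sub>x u"
  define m n r where "m = specular_partial ?X e\<^sub>x p" and "n = specular_partial ?X e\<^sub>t q"
    and "r = specular_partial ?X e\<^sub>t p"
  note S = S_half_plane_2[OF assms(3), folded p_def q_def, folded m_def n_def r_def]
  note sol = S_half_plane_2_solution[OF assms(3,4), folded p_def q_def, folded r_def]
  have cp: "continuous_on ?X p"
    by (rule continuous_on_half_plane_x) (fact S(3,8,9) S(12)[unfolded m_def])+
  have cq: "continuous_on ?X q"
    by (rule continuous_on_half_plane_t) (fact S(4,10,11) S(13)[unfolded n_def])+
  \<comment> \<open>The exceptional lines are those of the second specular t-derivative. By the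
    equation it is also the second specular x-derivative in the open half-plane, so the same lines
    serve both.\<close>
  have "piecewise_continuous ?X r" using S(5) by (simp add: S0_def)
  then obtain C where finC: "finite C" and nz: "0 \<notin> fst ` C"
    and cr: "continuous_on (?X - {z. \<exists>(c, b)\<in>C. c \<bullet> z = b}) r"
    by (rule piecewise_continuous_off_hyperplanes)
  have C: "c \<noteq> 0" if "(c, b) \<in> C" for c b
    using nz that by force
  define H E where "H = (UNIV :: real set) \<times> {0::real<..}" and "E = {z. \<exists>(c, b)\<in>C. c \<bullet> z = b}"
  have H: "open H" unfolding H_def by (intro open_Times) auto
  have HX: "H \<subseteq> ?X" by (auto simp: H_def)
  have HE: "open (H - E)"
    unfolding E_def by (intro open_Diff H closed_finite_hyperplanes finC)
  have cr: "continuous_on (H - E) r"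
    using cr HX unfolding E_def by (rule continuous_on_subset[OF _ Diff_mono]) auto
  have rq: "r z = specular_partial ?X e\<^sub>x q z" if "z \<in> H" for z
    using sol(2) that by (simp add: H_def)
  have u0: "u (y, 0) = \<phi> y" for y
    using assms(4) by (simp add: solves_wave_ivp_def)
  have "u (x, t) = 1 / 2 * (u (x + t, 0) + u (x - t, 0)) + 1 / 2 * integral {x - t..x + t} (\<lambda>s. p (s, 0))"
  proof (rule dAlembert_formula[OF finC C, folded closed_half_plane_def H_def E_def])
    show "continuous_on ?X u" "continuous_on ?X p" "continuous_on ?X q" by (fact S cp cq)+
    show "continuous_on H m" "continuous_on H n"
      using S(12,13) HX by (auto intro: continuous_on_subset)
    show "continuous_on (H - E) r" by (fact cr)
    show "0 \<le> t" by (fact t)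
    show "((\<lambda>z. u (z, 0)) has_real_derivative q (y, 0)) (at y)" for y
      unfolding q_def using S(2,6) cq
      by (intro DERIV_e_x[where S = UNIV]) (auto simp: q_def)
    fix y s
    show "((\<lambda>z. u (y, z)) has_real_derivative p (y, s)) (at s)" if "(y, s) \<in> H"
      unfolding p_def using S(2,7) continuous_on_subset[OF cp HX] that H
      by (intro DERIV_e_t[where S = H]) (auto simp: p_def H_def)
    show "((\<lambda>z. u (z, s)) has_real_derivative q (y, s)) (at y)" if "(y, s) \<in> H"
      unfolding q_def using S(2,6) cq that
      by (intro DERIV_e_x[where S = UNIV]) (auto simp: q_def H_def)
    show "((\<lambda>z. p (z, s)) has_real_derivative m (y, s)) (at y)" if "(y, s) \<in> H"
      unfolding m_def using S(3,8,12) that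
      by (intro DERIV_e_x[where S = UNIV]) (auto simp: m_def H_def)
    show "((\<lambda>z. q (y, z)) has_real_derivative n (y, s)) (at s)" if "(y, s) \<in> H"
      unfolding n_def using S(4,11) continuous_on_subset[OF S(13) HX] that H
      by (intro DERIV_e_t[where S = H]) (auto simp: n_def H_def)
    show "((\<lambda>z. p (y, z)) has_real_derivative r (y, s)) (at s)" if "(y, s) \<in> H - E"
      unfolding r_def using S(3,9) cr that HE
      by (intro DERIV_e_t[where S = "H - E"]) (auto simp: r_def H_def)
    show "((\<lambda>z. q (z, s)) has_real_derivative r (y, s)) (at y)" if z: "(y, s) \<in> H - E"
    proof -
      \<comment> \<open>The equation transfers the continuity of \<open>r\<close> to the second
        specular x-derivative, which makes it classical off \<open>E\<close>.\<close>
      have "continuous_on (H - E) (specular_partial ?X e\<^sub>x q)"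
        using cr by (rule continuous_on_eq) (use rq in auto)
      then have "continuous_on ((H - E) \<inter> ?X) (specular_partial ?X e\<^sub>x q)"
        by (rule continuous_on_subset) auto
      then have "((\<lambda>z. q (z, s)) has_real_derivative specular_partial ?X e\<^sub>x q (y, s)) (at y)"
        using S(4,10) z HE by (intro DERIV_e_x[where S = "H - E"]) (auto simp: H_def)
      then show ?thesis using rq z by simp
    qed
  qed
  then show "u (x, t) = 1 / 2 * (\<phi> (x + t) + \<phi> (x - t)) + 1 / 2 * integral {x - t..x + t} \<psi>"
    by (simp add: u0 sol(1))
qed

end
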